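(* Let $(s,u)$, with $s=(x,y,\theta,z_1,z_2,z_3)\in W^{1,2}([0,t_f];\mathbb{R}^6)$ and $u\in L^\infty([0,t_f];\mathbb{R})$, be an optimal pair for Problem (P3), and let $\lambda=(\lambda_x,\lambda_y,\lambda_\theta,\lambda_{z_1},\lambda_{z_2},\lambda_{z_3})$ be the associated adjoint variable vector (both defined in the context). Then for almost every $t\in[0,t_f]$, $$u(t)=\begin{cases} v\,a, & \text{if } \lambda_\theta(t)<0,\\ -v\,a, & \text{if } \lambda_\theta(t)>0,\\ \text{undetermined}, & \text{if } \lambda_\theta(t)=0,\end{cases}$$ where "undetermined" means that no assertion is made about $u(t)$ (beyond $|u(t)|\le va$) when $\lambda_\theta(t)=0$.
   Context: Fix real constants $v>0$ (speed), $a>0$, $t_f>0$ and initial data $x_0,y_0,\theta_0\in\mathbb{R}$. Problem (P3): minimize $\varphi(s(t_f)) := z_3(t_f)^2 - z_1(t_f)\,z_2(t_f)$ over all pairs $(s,u)$ with $s=(x,y,\theta,z_1,z_2,z_3)\in W^{1,2}([0,t_f];\mathbb{R}^6)$ and $u\in L^\infty([0,t_f];\mathbb{R})$ satisfying, for a.e. $t\in[0,t_f]$, $$\dot x = v\cos\theta,\quad \dot y = v\sin\theta,\quad \dot\theta = u/v,\quad \dot z_1=\frac{x^2}{(x^2+y^2)^2},\quad \dot z_2=\frac{y^2}{(x^2+y^2)^2},\quad \dot z_3=\frac{xy}{(x^2+y^2)^2},$$ $$x(0)=x_0,\quad y(0)=y_0,\quad \theta(0)=\theta_0,\quad z_1(0)=z_2(0)=z_3(0)=0,\qquad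 -va\le u(t)\le va .$$ (Absolute continuity of $z_1,z_2$ forces $x^2+y^2>0$ on $[0,t_f]$.) A pair is optimal if it is feasible and attains the minimum of $\varphi(s(t_f))$ among all feasible pairs. Hamiltonian: $$H(s,u,\lambda)=\lambda_x v\cos\theta+\lambda_y v\sin\theta+\lambda_\theta\frac{u}{v}+\lambda_{z_1}\frac{x^2}{(x^2+y^2)^2}+\lambda_{z_2}\frac{y^2}{(x^2+y^2)^2}+\lambda_{z_3}\frac{xy}{(x^2+y^2)^2}.$$ Adjoint variable vector: given $(s,u)$, $\lambda:[0,t_f]\to\mathbb{R}^6$ is the solution of $\dot\lambda(t)=-\partial H/\partial s\,(s(t),u(t),\lambda(t))$, $\lambda(t_f)=\partial\varphi/\partial s\,(s(t_f))$. Explicitly, with $\bar z_i:=z_i(t_f)$: $\lambda_{z_1}\equiv-\bar z_2$, $\lambda_{z_2}\equiv-\bar z_1$, $\lambda_{z_3}\equiv 2\bar z_3$, and $$\dot\lambda_x=\frac{-2\bar z_2x^3+6\bar z_3x^2y+2(\bar z_2-2\bar z_1)xy^2-2\bar z_3y^3}{(x^2+y^2)^3},\quad \lambda_x(t_f)=0,$$ $$\dot\lambda_y=\frac{-2\bar z_1y^3+6\bar z_3y^2x+2(\bar z_1-2\bar z_2)yx^2-2\bar z_3x^3}{(x^2+y^2)^3},\quad \lambda_y(t_f)=0,$$ $$\dot\lambda_\theta=v(\lambda_x\sin\theta-\lambda_y\cos\theta),\quad \lambda_\theta(t_f)=0.$$ *)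

theory Defs
  imports "HOL-Analysis.Analysis"
begin

text \<open>
  \<open>D division_of S\<close> is a finite family of compact intervals with pairwise disjoint interiors whose
  union is \<open>S\<close>, so that \<open>S\<close> below ranges over all finite unions of subintervals of \<open>I\<close>.
\<close>

definition abs_continuous_on :: "real set \<Rightarrow> (real \<Rightarrow> 'b::real_normed_vector) \<Rightarrow> bool" where
  "abs_continuous_on I f \<longleftrightarrow>
     (\<forall>e>0. \<exists>d>0. \<forall>D S. D division_of S \<and> S \<subseteq> I \<and> (\<Sum>k\<in>D. measure lborel k) < d \<longrightarrow>
        (\<Sum>k\<in>D. norm (f (interval_upperbound k) - f (interval_lowerbound k))) < e)"

text \<open>
  Elements of \<open>W\<^sup>1\<^sup>,\<^sup>2\<close> of a compact interval are represented by their absolutely continuous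
  representatives: the absolutely continuous functions whose almost-everywhere derivative is
  square integrable.  Trajectories are total functions on \<^typ>\<open>real\<close>, but only their
  values on \<open>{0..T}\<close> matter here and below.
\<close>

definition W12 :: "real \<Rightarrow> (real \<Rightarrow> 'b::euclidean_space) \<Rightarrow> bool" where
  "W12 T f \<longleftrightarrow> abs_continuous_on {0..T} f \<and>
     (\<exists>g. (AE t in lebesgue_on {0..T}. (f has_vector_derivative g t) (at t within {0..T})) \<and>
          g \<in> borel_measurable (lebesgue_on {0..T}) \<and>
          integrable (lebesgue_on {0..T}) (\<lambda>t. (norm (g t))\<^sup>2))"

definition Linfty :: "real \<Rightarrow> (real \<Rightarrow> real) \<Rightarrow> bool" where
  "Linfty T u \<longleftrightarrow> u \<in> borel_measurable (lebesgue_on {0..T}) \<and>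
     (\<exists>C. AE t in lebesgue_on {0..T}. \<bar>u t\<bar> \<le> C)"

text \<open>States \<open>(x, y, \<theta>, z\<^sub>1, z\<^sub>2, z\<^sub>3)\<close>; the inner product on the nested
  product type is the standard one of six-dimensional Euclidean space.\<close>

type_synonym state = "real \<times> real \<times> real \<times> real \<times> real \<times> real"

fun dynamics :: "real \<Rightarrow> state \<Rightarrow> real \<Rightarrow> state" where
  "dynamics v (x, y, \<theta>, z1, z2, z3) u =
     (v * cos \<theta>, v * sin \<theta>, u / v,
      x\<^sup>2 / (x\<^sup>2 + y\<^sup>2)\<^sup>2, y\<^sup>2 / (x\<^sup>2 + y\<^sup>2)\<^sup>2, x * y / (x\<^sup>2 + y\<^sup>2)\<^sup>2)"

fun cost :: "state \<Rightarrow> real" where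
  "cost (x, y, \<theta>, z1, z2, z3) = z3\<^sup>2 - z1 * z2"

fun hamiltonian :: "real \<Rightarrow> state \<Rightarrow> real \<Rightarrow> state \<Rightarrow> real" where
  "hamiltonian v (x, y, \<theta>, z1, z2, z3) u (lx, ly, l\<theta>, lz1, lz2, lz3) =
     lx * v * cos \<theta> + ly * v * sin \<theta> + l\<theta> * (u / v)
     + lz1 * (x\<^sup>2 / (x\<^sup>2 + y\<^sup>2)\<^sup>2) + lz2 * (y\<^sup>2 / (x\<^sup>2 + y\<^sup>2)\<^sup>2)
     + lz3 * (x * y / (x\<^sup>2 + y\<^sup>2)\<^sup>2)"

text \<open>
  The convention \<open>r / 0 = 0\<close> does not enlarge the feasible set when \<open>v > 0\<close>.  Since
  \<open>(x, y)\<close> is \<open>C\<^sup>1\<close> with speed \<open>v\<close>, its zeros are isolated, and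
  near a zero at \<open>t\<^sub>0\<close> one has \<open>z1' + z2' = 1 / (x\<^sup>2 + y\<^sup>2) \<ge> 1 / (v * (t - t\<^sub>0))\<^sup>2\<close> almost
  everywhere, which is impossible for absolutely continuous \<open>z1\<close> and \<open>z2\<close>.  So feasibility
  forces \<open>x\<^sup>2 + y\<^sup>2 > 0\<close> on the whole interval without a separate clause.
\<close>

definition feasible ::
    "real \<Rightarrow> real \<Rightarrow> real \<Rightarrow> real \<Rightarrow> real \<Rightarrow> real \<Rightarrow> (real \<Rightarrow> state) \<Rightarrow> (real \<Rightarrow> real) \<Rightarrow> bool" where
  "feasible v a tf x0 y0 \<theta>0 s u \<longleftrightarrow>
     W12 tf s \<and> Linfty tf u \<and>
     s 0 = (x0, y0, \<theta>0, 0, 0, 0) \<and>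
     (AE t in lebesgue_on {0..tf}.
        (s has_vector_derivative dynamics v (s t) (u t)) (at t within {0..tf}) \<and>
        - (v * a) \<le> u t \<and> u t \<le> v * a)"

definition optimal ::
    "real \<Rightarrow> real \<Rightarrow> real \<Rightarrow> real \<Rightarrow> real \<Rightarrow> real \<Rightarrow> (real \<Rightarrow> state) \<Rightarrow> (real \<Rightarrow> real) \<Rightarrow> bool" where
  "optimal v a tf x0 y0 \<theta>0 s u \<longleftrightarrow>
     feasible v a tf x0 y0 \<theta>0 s u \<and>
     (\<forall>s' u'. feasible v a tf x0 y0 \<theta>0 s' u' \<longrightarrow> cost (s tf) \<le> cost (s' tf))"

text \<open>
  The adjoint equation \<open>\<lambda>' = - \<partial>H/\<partial>s\<close>, \<open>\<lambda>(tf) = \<partial>\<phi>/\<partial>s(s(tf))\<close>, in the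
  Caratheodory sense, with the partial derivative in \<open>s\<close> expressed as a gradient.
\<close>

definition adjoint_of ::
    "real \<Rightarrow> real \<Rightarrow> (real \<Rightarrow> state) \<Rightarrow> (real \<Rightarrow> real) \<Rightarrow> (real \<Rightarrow> state) \<Rightarrow> bool" where
  "adjoint_of v tf s u l \<longleftrightarrow>
     abs_continuous_on {0..tf} l \<and>
     (AE t in lebesgue_on {0..tf}.
        \<exists>G. GDERIV (\<lambda>\<sigma>. hamiltonian v \<sigma> (u t) (l t)) (s t) :> G \<and>
            (l has_vector_derivative - G) (at t within {0..tf})) \<and>
     GDERIV cost (s tf) :> l tf"

end

theory Submission
  imports Defs
begin

text \<open>
  The control enters the dynamics affinely and only through \<open>\<theta>' = u / v\<close>, so the convex combination
  \<open>(1 - e) u + e w\<close> with an admissible continuous \<open>w\<close> turns \<open>\<theta>\<close> into \<open>\<theta> + e \<eta>\<close> with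
  \<open>\<eta>' = (w - u) / v\<close>, while \<open>x, y\<close> and then \<open>z\<^sub>1, z\<^sub>2, z\<^sub>3\<close> are obtained by iterated
  integration; no differential equation has to be solved.  By optimality the derivative of the cost at
  \<open>e = 0\<close> is nonnegative, and pairing the linearised trajectory with the adjoint variable identifies it
  with \<open>\<integral> \<lambda>\<^sub>\<theta> (w - u) / v\<close>.  Letting \<open>w = - v a \<lambda>\<^sub>\<theta> / (\<bar>\<lambda>\<^sub>\<theta>\<bar> + \<epsilon>)\<close> with \<open>\<epsilon>\<close> tending to \<open>0\<close> gives
  \<open>\<integral> (v a \<bar>\<lambda>\<^sub>\<theta>\<bar> + \<lambda>\<^sub>\<theta> u) \<le> 0\<close>, whose integrand is nonnegative and hence vanishes almost everywhere.
  Continuous \<open>w\<close> suffice, so that Lebesgue's differentiation theorem is never needed.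
\<close>

section \<open>Absolutely continuous functions\<close>

text \<open>The tag \<open>x\<close> lies between the endpoints, so the two linearisation errors add
  up to \<open>e\<close> times the full length \<open>v - u\<close>. This bounds a single summand of
  the gauge integral sum below.\<close>

lemma straddle_bound:
  fixes f :: "real \<Rightarrow> 'a::real_normed_vector"
  assumes "u \<le> x" "x \<le> v"
    and "norm (f u - f x - (u - x) *\<^sub>R f') \<le> e * norm (u - x)"
    and "norm (f v - f x - (v - x) *\<^sub>R f') \<le> e * norm (v - x)"
  shows "norm ((v - u) *\<^sub>R f' - (f v - f u)) \<le> e * (v - u)"
proof -
  have "norm ((v - u) *\<^sub>R f' - (f v - f u))
      = norm ((f u - f x - (u - x) *\<^sub>R f') - (f v - f x - (v - x) *\<^sub>R f'))"
    by (auto simp: algebra_simps)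
  also have "\<dots> \<le> e * norm (u - x) + e * norm (v - x)"
    using norm_triangle_ineq4 assms(3,4) by (smt (verit, best))
  also have "\<dots> = e * (v - u)"
    using assms(1,2) by (simp add: algebra_simps)
  finally show ?thesis .
qed

lemma abs_continuous_onE:
  assumes "abs_continuous_on I f" "e > 0"
  obtains d where "d > 0"
    "\<And>D S. D division_of S \<Longrightarrow> S \<subseteq> I \<Longrightarrow> (\<Sum>k\<in>D. measure lborel k) < d \<Longrightarrow>
        (\<Sum>k\<in>D. norm (f (interval_upperbound k) - f (interval_lowerbound k))) < e"
proof -
  from assms obtain d where "d > 0" "\<forall>D S. D division_of S \<and> S \<subseteq> I \<and> (\<Sum>k\<in>D. measure lborel k) < d \<longrightarrow>
        (\<Sum>k\<in>D. norm (f (interval_upperbound k) - f (interval_lowerbound k))) < e"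
    unfolding abs_continuous_on_def by blast
  then show thesis using that by blast
qed

lemma abs_continuous_on_subset:
  assumes "abs_continuous_on I f" "J \<subseteq> I"
  shows "abs_continuous_on J f"
  unfolding abs_continuous_on_def
proof (intro allI impI)
  fix e :: real assume "e > 0"
  with assms(1) obtain d where "d > 0"
    "\<And>D S. D division_of S \<Longrightarrow> S \<subseteq> I \<Longrightarrow> (\<Sum>k\<in>D. measure lborel k) < d \<Longrightarrow>
        (\<Sum>k\<in>D. norm (f (interval_upperbound k) - f (interval_lowerbound k))) < e"
    by (rule abs_continuous_onE) blast
  then show "\<exists>d>0. \<forall>D S. D division_of S \<and> S \<subseteq> J \<and> (\<Sum>k\<in>D. measure lborel k) < d \<longrightarrow>
        (\<Sum>k\<in>D. norm (f (interval_upperbound k) - f (interval_lowerbound k))) < e"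
    using assms(2) by (intro exI[of _ d]) auto
qed

lemma abs_continuous_on_norm_le:
  assumes "abs_continuous_on I f"
    and le: "\<And>s t. norm (g t - g s) \<le> K * norm (f t - f s)"
  shows "abs_continuous_on I g"
  unfolding abs_continuous_on_def
proof (intro allI impI)
  fix e :: real assume "e > 0"
  \<comment> \<open>\<open>K\<close> may be zero or negative, so \<open>\<bar>K\<bar> + 1\<close>
    serves as a strictly positive factor.\<close>
  then have "e / (\<bar>K\<bar> + 1) > 0" by (simp add: add_nonneg_pos)
  then obtain d where "d > 0" and d: "\<And>D S. D division_of S \<Longrightarrow> S \<subseteq> I \<Longrightarrow> (\<Sum>k\<in>D. measure lborel k) < d \<Longrightarrow>
        (\<Sum>k\<in>D. norm (f (interval_upperbound k) - f (interval_lowerbound k))) < e / (\<bar>K\<bar> + 1)"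
    by (rule abs_continuous_onE[OF assms(1)]) blast
  show "\<exists>d>0. \<forall>D S. D division_of S \<and> S \<subseteq> I \<and> (\<Sum>k\<in>D. measure lborel k) < d \<longrightarrow>
        (\<Sum>k\<in>D. norm (g (interval_upperbound k) - g (interval_lowerbound k))) < e"
  proof (intro exI conjI allI impI)
    fix D S assume D: "D division_of S \<and> S \<subseteq> I \<and> (\<Sum>k\<in>D. measure lborel k) < d"
    have le': "norm (g t - g s) \<le> (\<bar>K\<bar> + 1) * norm (f t - f s)" for s t
      by (rule order_trans[OF le]) (simp add: mult_right_mono)
    have "(\<Sum>k\<in>D. norm (g (interval_upperbound k) - g (interval_lowerbound k)))
        \<le> (\<bar>K\<bar> + 1) * (\<Sum>k\<in>D. norm (f (interval_upperbound k) - f (interval_lowerbound k)))"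
      unfolding sum_distrib_left by (intro sum_mono le')
    also have "\<dots> < e"
      using d[of D S] D by (simp add: field_simps add_nonneg_pos)
    finally show "(\<Sum>k\<in>D. norm (g (interval_upperbound k) - g (interval_lowerbound k))) < e" .
  qed (use \<open>d > 0\<close> in simp)
qed

lemma division_of_real_elem:
  fixes S :: "real set"
  assumes "D division_of S" "k \<in> D"
  obtains a b where "a \<le> b" "k = {a..b}" "{a..b} \<subseteq> S"
  using division_ofD(2,3,4)[OF assms] by (metis atLeastatMost_empty' box_real(2))

lemma lipschitz_imp_abs_continuous_on:
  fixes f :: "real \<Rightarrow> 'a::real_normed_vector"
  assumes "L-lipschitz_on I f"
  shows "abs_continuous_on I f"
  unfolding abs_continuous_on_def
proof (intro allI impI)
  fix e :: real assume "e > 0"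
  have "L \<ge> 0" using assms by (simp add: lipschitz_on_nonneg)
  show "\<exists>d>0. \<forall>D S. D division_of S \<and> S \<subseteq> I \<and> (\<Sum>k\<in>D. measure lborel k) < d \<longrightarrow>
        (\<Sum>k\<in>D. norm (f (interval_upperbound k) - f (interval_lowerbound k))) < e"
  proof (intro exI[of _ "e / (L + 1)"] conjI allI impI)
    fix D S assume D: "D division_of S \<and> S \<subseteq> I \<and> (\<Sum>k\<in>D. measure lborel k) < e / (L + 1)"
    have "norm (f (interval_upperbound k) - f (interval_lowerbound k)) \<le> L * measure lborel k"
      if kD: "k \<in> D" for k
    proof -
      obtain a b where k: "a \<le> b" "k = {a..b}" "{a..b} \<subseteq> S"
        using division_of_real_elem[of D S k] D kD by blast
      have "a \<in> S" "b \<in> S" using k by auto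
      then have "a \<in> I" "b \<in> I" using D by blast+
      then show ?thesis
        using lipschitz_onD[OF assms, of b a] k by (auto simp: dist_norm)
    qed
    then have "(\<Sum>k\<in>D. norm (f (interval_upperbound k) - f (interval_lowerbound k)))
      \<le> L * (\<Sum>k\<in>D. measure lborel k)"
      unfolding sum_distrib_left by (rule sum_mono)
    also have "\<dots> \<le> (L + 1) * (\<Sum>k\<in>D. measure lborel k)"
      by (intro mult_right_mono sum_nonneg) auto
    also have "\<dots> < e"
      using D \<open>L \<ge> 0\<close> by (simp add: field_simps)
    finally show "(\<Sum>k\<in>D. norm (f (interval_upperbound k) - f (interval_lowerbound k))) < e" .
  qed (use \<open>e > 0\<close> \<open>L \<ge> 0\<close> in simp)
qed

lemma abs_continuous_on_imp_continuous_on: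
  fixes f :: "real \<Rightarrow> 'a::real_normed_vector"
  assumes ac: "abs_continuous_on {a..b} f"
  shows "continuous_on {a..b} f"
  unfolding continuous_on_iff
proof (intro ballI allI impI)
  fix t e :: real assume t: "t \<in> {a..b}" and "e > 0"
  then obtain d where "d > 0" and d: "\<And>D S. D division_of S \<Longrightarrow> S \<subseteq> {a..b} \<Longrightarrow> (\<Sum>k\<in>D. measure lborel k) < d \<Longrightarrow>
        (\<Sum>k\<in>D. norm (f (interval_upperbound k) - f (interval_lowerbound k))) < e"
    using abs_continuous_onE[OF ac \<open>e > 0\<close>] by blast
  have *: "norm (f q - f p) < e" if "a \<le> p" "p \<le> q" "q \<le> b" "q - p < d" for p q
    using d[of "{{p..q}}" "{p..q}"] that division_of_self[of p q] by (auto simp: box_real)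
  show "\<exists>d>0. \<forall>x'\<in>{a..b}. dist x' t < d \<longrightarrow> dist (f x') (f t) < e"
  proof (intro exI[of _ d] conjI ballI impI)
    fix s assume "s \<in> {a..b}" "dist s t < d"
    then show "dist (f s) (f t) < e"
      using *[of s t] *[of t s] t by (cases "s \<le> t") (auto simp: dist_norm norm_minus_commute)
  qed (rule \<open>d > 0\<close>)
qed

text \<open>Both factors are bounded on the compact interval, so the usual product splitting of the
  increments applies. It makes the pairing of the linearised trajectory with the adjoint absolutely
  continuous.\<close>

lemma abs_continuous_on_inner:
  fixes f g :: "real \<Rightarrow> 'a::real_inner"
  assumes f: "abs_continuous_on {a..b} f" and g: "abs_continuous_on {a..b} g"
  shows "abs_continuous_on {a..b} (\<lambda>t. inner (f t) (g t))"
proof -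
  have "bounded (f ` {a..b})" "bounded (g ` {a..b})"
    by (intro compact_imp_bounded compact_continuous_image abs_continuous_on_imp_continuous_on f g
        compact_Icc)+
  then obtain M N where "M > 0" "N > 0" and M: "\<And>t. t \<in> {a..b} \<Longrightarrow> norm (f t) \<le> M"
    and N: "\<And>t. t \<in> {a..b} \<Longrightarrow> norm (g t) \<le> N"
    unfolding bounded_pos by (metis imageI)
  show ?thesis
    unfolding abs_continuous_on_def
  proof (intro allI impI)
    fix e :: real assume "e > 0"
    \<comment> \<open>The increments of each factor get multiplied by the bound of the other one, so
      the tolerances are \<open>e / (2 * N)\<close> for \<open>f\<close> and
      \<open>e / (2 * M)\<close> for \<open>g\<close>.\<close>
    then have "e / (2 * M) > 0" "e / (2 * N) > 0" using \<open>M > 0\<close> \<open>N > 0\<close> by auto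
    obtain d1 where "d1 > 0" and d1: "\<And>D S. D division_of S \<Longrightarrow> S \<subseteq> {a..b} \<Longrightarrow> (\<Sum>k\<in>D. measure lborel k) < d1 \<Longrightarrow>
        (\<Sum>k\<in>D. norm (f (interval_upperbound k) - f (interval_lowerbound k))) < e / (2 * N)"
      by (rule abs_continuous_onE[OF f \<open>e / (2 * N) > 0\<close>]) blast
    obtain d2 where "d2 > 0" and d2: "\<And>D S. D division_of S \<Longrightarrow> S \<subseteq> {a..b} \<Longrightarrow> (\<Sum>k\<in>D. measure lborel k) < d2 \<Longrightarrow>
        (\<Sum>k\<in>D. norm (g (interval_upperbound k) - g (interval_lowerbound k))) < e / (2 * M)"
      by (rule abs_continuous_onE[OF g \<open>e / (2 * M) > 0\<close>]) blast
    show "\<exists>d>0. \<forall>D S. D division_of S \<and> S \<subseteq> {a..b} \<and> (\<Sum>k\<in>D. measure lborel k) < d \<longrightarrow>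
        (\<Sum>k\<in>D. norm (inner (f (interval_upperbound k)) (g (interval_upperbound k))
                     - inner (f (interval_lowerbound k)) (g (interval_lowerbound k)))) < e"
    proof (intro exI[of _ "min d1 d2"] conjI allI impI)
      fix D S assume D: "D division_of S \<and> S \<subseteq> {a..b} \<and> (\<Sum>k\<in>D. measure lborel k) < min d1 d2"
      have "norm (inner (f (interval_upperbound k)) (g (interval_upperbound k))
                     - inner (f (interval_lowerbound k)) (g (interval_lowerbound k)))
           \<le> N * norm (f (interval_upperbound k) - f (interval_lowerbound k))
           + M * norm (g (interval_upperbound k) - g (interval_lowerbound k))" if kD: "k \<in> D" for k
      proof -
        obtain p q where k: "p \<le> q" "k = {p..q}" "{p..q} \<subseteq> S"
          using division_of_real_elem[of D S k] D kD by blast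
        have "p \<in> S" "q \<in> S" using k by auto
        then have pq: "p \<in> {a..b}" "q \<in> {a..b}" using D by blast+
        have "inner (f q) (g q) - inner (f p) (g p) = inner (f q - f p) (g q) + inner (f p) (g q - g p)"
          by (simp add: inner_diff_left inner_diff_right)
        also have "norm \<dots> \<le> norm (f q - f p) * norm (g q) + norm (f p) * norm (g q - g p)"
          unfolding real_norm_def
          by (rule order_trans[OF abs_triangle_ineq add_mono[OF Cauchy_Schwarz_ineq2 Cauchy_Schwarz_ineq2]])
        also have "\<dots> \<le> norm (f q - f p) * N + M * norm (g q - g p)"
          using M[OF pq(1)] N[OF pq(2)] by (intro add_mono mult_left_mono mult_right_mono) auto
        finally show ?thesis using k by (simp add: mult.commute)
      qed
      then have "(\<Sum>k\<in>D. norm (inner (f (interval_upperbound k)) (g (interval_upperbound k))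
                     - inner (f (interval_lowerbound k)) (g (interval_lowerbound k))))
        \<le> N * (\<Sum>k\<in>D. norm (f (interval_upperbound k) - f (interval_lowerbound k)))
           + M * (\<Sum>k\<in>D. norm (g (interval_upperbound k) - g (interval_lowerbound k)))"
        unfolding sum_distrib_left sum.distrib[symmetric] by (rule sum_mono)
      also have "\<dots> < N * (e / (2 * N)) + M * (e / (2 * M))"
        using d1[of D S] d2[of D S] D \<open>M > 0\<close> \<open>N > 0\<close>
        by (intro add_strict_mono mult_strict_left_mono) auto
      also have "\<dots> = e" using \<open>M > 0\<close> \<open>N > 0\<close> by simp
      finally show "(\<Sum>k\<in>D. norm (inner (f (interval_upperbound k)) (g (interval_upperbound k))
                     - inner (f (interval_lowerbound k)) (g (interval_lowerbound k)))) < e" .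
    qed (use \<open>d1 > 0\<close> \<open>d2 > 0\<close> in simp)
  qed
qed

text \<open>A gauge separates the tags. Off \<open>N\<close> it enforces the straddle estimate. On
  \<open>N\<close> it confines the intervals to an open set of small measure, where absolute
  continuity makes the total increment of \<open>f\<close> small.\<close>

theorem fundamental_theorem_of_calculus_abs_continuous:
  fixes f :: "real \<Rightarrow> 'a::euclidean_space"
  assumes "a \<le> b" and ac: "abs_continuous_on {a..b} f" and N: "negligible N"
    and deriv: "\<And>t. t \<in> {a..b} - N \<Longrightarrow> (f has_vector_derivative f' t) (at t within {a..b})"
  shows "(f' has_integral (f b - f a)) {a..b}"
proof (cases "a = b")
  case True
  then show ?thesis by auto
next
  case False
  with \<open>a \<le> b\<close> have "a < b" by simp
  \<comment> \<open>With value 0 on \<open>N\<close>, a summand tagged in \<open>N\<close> consists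
    of the increment of \<open>f\<close> alone.\<close>
  define g where "g t = (if t \<in> N then 0 else f' t)" for t
  have "(g has_integral (f b - f a)) {a..b}"
    unfolding has_integral_factor_content_real
  proof (intro allI impI)
    fix e0 :: real assume "e0 > 0"
    \<comment> \<open>Tags inside and outside \<open>N\<close> each contribute at most
      \<open>e * (b - a)\<close>.\<close>
    define e where "e = e0 / 2"
    have "e > 0" using \<open>e0 > 0\<close> by (simp add: e_def)
    have "\<forall>x. \<exists>d>0. x \<in> {a..b} - N \<longrightarrow>
         (\<forall>y\<in>{a..b}. norm (y-x) < d \<longrightarrow> norm (f y - f x - (y-x) *\<^sub>R f' x) \<le> e * norm (y-x))"
      using deriv[unfolded has_vector_derivative_def has_derivative_within_alt] \<open>e > 0\<close> zero_less_one
      by meson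
    then obtain d where d: "\<And>x. 0 < d x"
                 "\<And>x y. \<lbrakk>x \<in> {a..b} - N; y \<in> {a..b}; norm (y-x) < d x\<rbrakk>
                        \<Longrightarrow> norm (f y - f x - (y-x) *\<^sub>R f' x) \<le> e * norm (y-x)"
      by metis
    have "e * (b - a) > 0" using \<open>e > 0\<close> \<open>a < b\<close> by simp
    then obtain r where "r > 0" and r: "\<And>D S. D division_of S \<Longrightarrow> S \<subseteq> {a..b} \<Longrightarrow> (\<Sum>k\<in>D. measure lborel k) < r \<Longrightarrow>
        (\<Sum>k\<in>D. norm (f (interval_upperbound k) - f (interval_lowerbound k))) < e * (b - a)"
      by (rule abs_continuous_onE[OF ac]) blast
    have Nl: "N \<in> sets lebesgue" "N \<in> null_sets lebesgue" using N by (auto simp: negligible_iff_null_sets)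
    obtain G where G: "open G" "N \<subseteq> G" "(G - N) \<in> lmeasurable" "emeasure lebesgue (G - N) < ennreal r"
      using sets_lebesgue_outer_open[OF Nl(1) \<open>r > 0\<close>] by blast
    have Gm: "G \<in> sets lebesgue" using G(1) by simp
    have emG: "emeasure lebesgue G < ennreal r"
      using G(4) emeasure_Diff_null_set[OF Nl(2) Gm] by simp
    then have Gl: "G \<in> lmeasurable"
      using Gm by (intro fmeasurableI) (auto intro: order_less_trans)
    have mG: "measure lebesgue G < r"
      using emG \<open>r > 0\<close> by (metis emeasure_eq_measure2 Gl ennreal_less_iff measure_nonneg)
    define \<gamma> where "\<gamma> x = (if x \<in> N then G else ball x (d x))" for x
    have "gauge \<gamma>"
      unfolding gauge_def \<gamma>_def using G d(1) by auto
    moreover have "norm ((\<Sum>(x, K)\<in>p. measure lborel K *\<^sub>R g x) - (f b - f a)) \<le> e0 * measure lborel {a..b}"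
      if ptag: "p tagged_division_of {a..b}" and fine: "\<gamma> fine p" for p
    proof -
      have "finite p" using ptag by blast
      let ?h = "\<lambda>(x, K). measure lborel K *\<^sub>R g x - (f (Sup K) - f (Inf K))"
      define q where "q = {(x, K) \<in> p. x \<in> N}"
      have "q \<subseteq> p" by (auto simp: q_def)
      then have "finite q" using \<open>finite p\<close> finite_subset by blast
      have K: "\<exists>u v. K = {u..v} \<and> u \<le> x \<and> x \<le> v \<and> a \<le> u \<and> v \<le> b" if xK: "(x, K) \<in> p" for x K
      proof -
        obtain u v where "K = {u..v}" using tagged_division_ofD(4)[OF ptag xK] box_real(2) by auto
        then show ?thesis
          using tagged_division_ofD(2,3)[OF ptag xK] by fastforce
      qed
      have ba: "b - a = (\<Sum>(x,K)\<in>p. Sup K - Inf K)" "f b - f a = (\<Sum>(x,K)\<in>p. f(Sup K) - f(Inf K))"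
        using additive_tagged_division_1[where f= "\<lambda>x. x"] additive_tagged_division_1[where f= f]
          \<open>a \<le> b\<close> ptag by auto
      have "(\<Sum>(x, K)\<in>p. measure lborel K *\<^sub>R g x) - (f b - f a) = (\<Sum>xK\<in>p. ?h xK)"
        by (auto simp: ba split_def sum_subtractf)
      also have "\<dots> = (\<Sum>xK\<in>p - q. ?h xK) + (\<Sum>xK\<in>q. ?h xK)"
        using sum.subset_diff[OF \<open>q \<subseteq> p\<close> \<open>finite p\<close>] .
      also have "norm \<dots> \<le> norm (\<Sum>xK\<in>p - q. ?h xK) + norm (\<Sum>xK\<in>q. ?h xK)"
        by (rule norm_triangle_ineq)
      also have "norm (\<Sum>xK\<in>p - q. ?h xK) \<le> (\<Sum>(x,K)\<in>p - q. e * (Sup K - Inf K))"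
      proof (rule sum_norm_le, safe)
        fix x K assume xK: "(x, K) \<in> p" "(x, K) \<notin> q"
        then have "x \<notin> N" by (auto simp: q_def)
        obtain u v where uv: "K = {u..v}" "u \<le> x" "x \<le> v" "a \<le> u" "v \<le> b" using K[OF xK(1)] by blast
        have "K \<subseteq> ball x (d x)" using fineD[OF fine xK(1)] \<open>x \<notin> N\<close> by (simp add: \<gamma>_def)
        moreover have "u \<in> K" "v \<in> K" using uv by auto
        ultimately have "norm (u - x) < d x" "norm (v - x) < d x" by (auto simp: dist_real_def)
        then have "norm ((v - u) *\<^sub>R f' x - (f v - f u)) \<le> e * (v - u)"
          using uv \<open>x \<notin> N\<close> by (intro straddle_bound[of u x v] d(2)) auto
        then show "norm (measure lborel K *\<^sub>R g x - (f (Sup K) - f (Inf K))) \<le> e * (Sup K - Inf K)"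
          using uv \<open>x \<notin> N\<close> by (simp add: g_def)
      qed
      \<comment> \<open>Restoring the nonnegative lengths of the intervals in \<open>q\<close> lets
        the sum telescope to \<open>b - a\<close>.\<close>
      also have "\<dots> \<le> (\<Sum>(x,K)\<in>p. e * (Sup K - Inf K))"
      proof (rule sum_mono2[OF \<open>finite p\<close>])
        fix xK assume "xK \<in> p - (p - q)"
        then show "0 \<le> (case xK of (x, K) \<Rightarrow> e * (Sup K - Inf K))"
          using K \<open>e > 0\<close> by (cases xK) fastforce
      qed auto
      also have "\<dots> = e * (b - a)"
        by (simp add: ba(1) split_def sum_distrib_left)
      also have "norm (\<Sum>xK\<in>q. ?h xK) \<le> e * (b - a)"
      proof -
        \<comment> \<open>The intervals tagged in \<open>N\<close> form a division of their union,
          which lies in \<open>G\<close>. Their total length is therefore below \<open>r\<close>,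
          the threshold supplied by absolute continuity.\<close>
        have qt: "q tagged_division_of (\<Union>(snd ` q))"
          using tagged_partial_division_of_Union_self tagged_partial_division_subset
            tagged_division_of_def ptag \<open>q \<subseteq> p\<close> by metis
        have qd: "snd ` q division_of \<Union>(snd ` q)" by (rule division_of_tagged_division[OF qt])
        have "K \<subseteq> G \<and> K \<subseteq> {a..b}" if "(x, K) \<in> q" for x K
        proof -
          have "(x, K) \<in> p" "x \<in> N" using that by (auto simp: q_def)
          then show ?thesis
            using fineD[OF fine, of x K] tagged_division_ofD(3)[OF ptag] by (simp add: \<gamma>_def)
        qed
        then have sub: "\<Union>(snd ` q) \<subseteq> G" "\<Union>(snd ` q) \<subseteq> {a..b}"
          by fastforce+
        have "(\<Sum>k\<in>snd ` q. measure lborel k) = (\<Sum>k\<in>snd ` q. measure lebesgue k)"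
        proof (intro sum.cong refl)
          fix k assume "k \<in> snd ` q"
          then obtain u v where "u \<le> v" "k = {u..v}" by (rule division_of_real_elem[OF qd])
          then show "measure lborel k = measure lebesgue k" by simp
        qed
        also have "\<dots> = measure lebesgue (\<Union>(snd ` q))"
          by (rule content_division[OF qd])
        also have "\<dots> \<le> measure lebesgue G"
          using sub lmeasurable_division[OF qd] Gl by (intro measure_mono_fmeasurable) auto
        finally have "(\<Sum>k\<in>snd ` q. measure lborel k) < r" using mG by simp
        then have small: "(\<Sum>k\<in>snd ` q. norm (f (interval_upperbound k) - f (interval_lowerbound k))) < e * (b - a)"
          using r qd sub by blast
        have "norm (\<Sum>xK\<in>q. ?h xK)
           \<le> (\<Sum>(x,k)\<in>q. norm (f (interval_upperbound k) - f (interval_lowerbound k)))"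
        proof (rule sum_norm_le, safe)
          fix x K assume "(x, K) \<in> q"
          then have "x \<in> N" "(x, K) \<in> p" by (auto simp: q_def)
          then obtain u v where uv: "K = {u..v}" "u \<le> x" "x \<le> v" using K by blast
          then show "norm (measure lborel K *\<^sub>R g x - (f (Sup K) - f (Inf K)))
            \<le> norm (f (interval_upperbound K) - f (interval_lowerbound K))"
            using \<open>x \<in> N\<close> by (simp add: g_def norm_minus_commute)
        qed
        \<comment> \<open>Distinct tagged pairs can share an interval only if its interior is empty;
          on a nonempty one the increment is 0. The guard gives the empty set the value 0 as well,
          so the sum may be indexed by the intervals themselves.\<close>
        also have "\<dots> = (\<Sum>(x,k)\<in>q. if k = {} then 0 else
            norm (f (interval_upperbound k) - f (interval_lowerbound k)))"
          using K \<open>q \<subseteq> p\<close> by (intro sum.cong) fastforce+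
        also have "\<dots> = (\<Sum>k\<in>snd ` q. if k = {} then 0 else
            norm (f (interval_upperbound k) - f (interval_lowerbound k)))"
        proof (rule sum.over_tagged_division_lemma[OF qt])
          fix u v :: real assume "box u v = {}"
          then have "v \<le> u" by simp
          then show "(if cbox u v = {} then 0 else
              norm (f (interval_upperbound (cbox u v)) - f (interval_lowerbound (cbox u v)))) = 0"
            by auto
        qed
        also have "\<dots> = (\<Sum>k\<in>snd ` q. norm (f (interval_upperbound k) - f (interval_lowerbound k)))"
          using qd by (intro sum.cong) (auto dest: division_ofD(3))
        finally show ?thesis using small by simp
      qed
      finally show ?thesis using \<open>a \<le> b\<close> by (simp add: e_def)
    qed
    ultimately show "\<exists>d. gauge d \<and> (\<forall>p. p tagged_division_of {a..b} \<and> d fine p \<longrightarrow>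
        norm ((\<Sum>(x, k)\<in>p. measure lborel k *\<^sub>R g x) - (f b - f a)) \<le> e0 * measure lborel {a..b})"
      by (intro exI[of _ \<gamma>] conjI allI impI) simp_all
  qed
  then show ?thesis
    by (rule has_integral_spike[OF N, rotated]) (auto simp: g_def)
qed

section \<open>From almost-everywhere derivatives to integral formulas and Lipschitz bounds\<close>

lemma AE_lebesgue_on_iff_negligible:
  assumes "S \<in> sets lebesgue"
  shows "(AE t in lebesgue_on S. P t) \<longleftrightarrow> (\<exists>N. negligible N \<and> (\<forall>t\<in>S - N. P t))"
proof -
  have "(AE t in lebesgue_on S. P t) \<longleftrightarrow> (AE t in lebesgue. t \<in> S \<longrightarrow> P t)"
    using assms by (simp add: AE_restrict_space_iff)
  also have "\<dots> \<longleftrightarrow> (\<exists>N. negligible N \<and> (\<forall>t\<in>S - N. P t))"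
    by (auto simp: eventually_ae_filter negligible_iff_null_sets)
  finally show ?thesis .
qed

lemma abs_continuous_on_has_integral:
  fixes f :: "real \<Rightarrow> 'a::euclidean_space"
  assumes ac: "abs_continuous_on {a..b} f" and N: "negligible N"
    and deriv: "\<And>t. t \<in> {a..b} - N \<Longrightarrow> (f has_vector_derivative f' t) (at t within {a..b})"
    and "a \<le> p" "p \<le> q" "q \<le> b"
  shows "(f' has_integral (f q - f p)) {p..q}"
proof (rule fundamental_theorem_of_calculus_abs_continuous[OF \<open>p \<le> q\<close> _ N])
  show "abs_continuous_on {p..q} f"
    by (rule abs_continuous_on_subset[OF ac]) (use assms in auto)
  show "(f has_vector_derivative f' t) (at t within {p..q})" if "t \<in> {p..q} - N" for t
    by (rule has_vector_derivative_within_subset[OF deriv]) (use assms that in auto)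
qed

text \<open>The fundamental theorem exhibits \<open>f\<close> as a primitive of a continuous
  function, so the exceptional set disappears. This yields the equations for \<open>x\<close> and
  \<open>y\<close> at every time and the integral formulas for \<open>x\<close>, \<open>y\<close>
  and the three \<open>z\<close> components.\<close>

lemma abs_continuous_on_continuous_derivative:
  fixes f :: "real \<Rightarrow> 'a::euclidean_space"
  assumes ac: "abs_continuous_on {a..b} f" and N: "negligible N"
    and deriv: "\<And>t. t \<in> {a..b} - N \<Longrightarrow> (f has_vector_derivative f' t) (at t within {a..b})"
    and cont: "continuous_on {a..b} f'" and t: "t \<in> {a..b}"
  shows "f t = f a + integral {a..t} f'"
    and "(f has_vector_derivative f' t) (at t within {a..b})"
proof -
  have eq: "f t = f a + integral {a..t} f'" if "t \<in> {a..b}" for t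
    using abs_continuous_on_has_integral[OF ac N deriv, of a t] that by (simp add: integral_unique)
  then show "f t = f a + integral {a..t} f'" using t by blast
  have deriv': "((\<lambda>t. f a + integral {a..t} f') has_vector_derivative 0 + f' t) (at t within {a..b})"
    by (intro has_vector_derivative_add has_vector_derivative_const
        integral_has_vector_derivative[OF cont t])
  show "(f has_vector_derivative f' t) (at t within {a..b})"
    using has_vector_derivative_transform[OF t eq deriv'] by simp
qed

lemma has_vector_derivative_lipschitz:
  fixes f :: "real \<Rightarrow> 'a::real_normed_vector"
  assumes "\<And>t. t \<in> {a..b} \<Longrightarrow> (f has_vector_derivative f' t) (at t within {a..b})"
    and "\<And>t. t \<in> {a..b} \<Longrightarrow> norm (f' t) \<le> L" and "0 \<le> L"
  shows "L-lipschitz_on {a..b} f"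
proof (rule bounded_derivative_imp_lipschitz)
  show "(f has_derivative (\<lambda>h. h *\<^sub>R f' t)) (at t within {a..b})" if "t \<in> {a..b}" for t
    using assms(1)[OF that] by (simp add: has_vector_derivative_def)
  show "onorm (\<lambda>h. h *\<^sub>R f' t) \<le> L" if "t \<in> {a..b}" for t
    using assms(2)[OF that] by (intro onorm_le) (simp add: mult_left_mono mult.commute[of L])
qed (use assms in auto)

section \<open>Trajectories of constant speed and the origin\<close>

lemma eventually_nonzero_of_derivative:
  fixes f :: "real \<Rightarrow> real"
  assumes "(f has_vector_derivative c) (at t within S)" "c \<noteq> 0" "f t = 0"
  shows "\<forall>\<^sub>F s in at t within S. f s \<noteq> 0"
proof -
  have "((\<lambda>s. (f s - f t) / (s - t)) \<longlongrightarrow> c) (at t within S)"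
    using assms(1) by (simp add: has_real_derivative_iff_has_vector_derivative[symmetric] has_field_derivative_iff)
  then have "\<forall>\<^sub>F s in at t within S. (f s - f t) / (s - t) \<noteq> 0"
    using assms(2) by (rule tendsto_imp_eventually_ne)
  then show ?thesis by eventually_elim (use assms in auto)
qed

text \<open>Along a curve of constant speed the density \<open>1 / (x\<^sup>2 + y\<^sup>2)\<close> is not integrable near a
  zero of \<open>(x, y)\<close>, since the distance to that zero grows at most linearly.\<close>

lemma curve_avoids_origin:
  fixes x y \<theta> W :: "real \<Rightarrow> real"
  assumes "v > 0" "T > 0"
    and dx: "\<And>t. t \<in> {0..T} \<Longrightarrow> (x has_vector_derivative v * cos (\<theta> t)) (at t within {0..T})"
    and dy: "\<And>t. t \<in> {0..T} \<Longrightarrow> (y has_vector_derivative v * sin (\<theta> t)) (at t within {0..T})"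
    and ac: "abs_continuous_on {0..T} W" and N: "negligible N"
    and dW: "\<And>t. t \<in> {0..T} - N \<Longrightarrow> (W has_vector_derivative
       ((x t)\<^sup>2 / ((x t)\<^sup>2 + (y t)\<^sup>2)\<^sup>2 + (y t)\<^sup>2 / ((x t)\<^sup>2 + (y t)\<^sup>2)\<^sup>2)) (at t within {0..T})"
    and t0: "t0 \<in> {0..T}"
  shows "(x t0)\<^sup>2 + (y t0)\<^sup>2 > 0"
proof (rule ccontr)
  assume "\<not> (x t0)\<^sup>2 + (y t0)\<^sup>2 > 0"
  then have 0: "x t0 = 0" "y t0 = 0"
    by (auto simp: not_less sum_power2_le_zero_iff)
  let ?w = "\<lambda>t. (x t)\<^sup>2 / ((x t)\<^sup>2 + (y t)\<^sup>2)\<^sup>2 + (y t)\<^sup>2 / ((x t)\<^sup>2 + (y t)\<^sup>2)\<^sup>2"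
  have "v-lipschitz_on {0..T} x" "v-lipschitz_on {0..T} y"
    using \<open>v > 0\<close> by (auto intro!: has_vector_derivative_lipschitz dx dy simp: abs_mult)
  then have "\<bar>x t\<bar> \<le> v * \<bar>t - t0\<bar>" "\<bar>y t\<bar> \<le> v * \<bar>t - t0\<bar>" if "t \<in> {0..T}" for t
    using lipschitz_onD[of v "{0..T}" x t t0] lipschitz_onD[of v "{0..T}" y t t0] that t0 0
    by (auto simp: dist_real_def)
  then have "(x t)\<^sup>2 \<le> (v * \<bar>t - t0\<bar>)\<^sup>2" "(y t)\<^sup>2 \<le> (v * \<bar>t - t0\<bar>)\<^sup>2" if "t \<in> {0..T}" for t
    using that \<open>v > 0\<close> by (intro power2_le_iff_abs_le[THEN iffD2]; simp)+
  then have r_le: "(x t)\<^sup>2 + (y t)\<^sup>2 \<le> 2 * v\<^sup>2 * (t - t0)\<^sup>2" if "t \<in> {0..T}" for t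
    using that by (fastforce simp: power_mult_distrib)
  \<comment> \<open>The velocity never vanishes, so the zero at \<open>t0\<close> is isolated. This
    matters because division by zero makes \<open>?w\<close> equal to 0 at any zero of
    \<open>(x, y)\<close>, where the lower bound would fail.\<close>
  have "v * cos (\<theta> t0) \<noteq> 0 \<or> v * sin (\<theta> t0) \<noteq> 0"
    using \<open>v > 0\<close> sin_zero_abs_cos_one[of "\<theta> t0"] by auto
  then have "\<forall>\<^sub>F t in at t0 within {0..T}. x t \<noteq> 0 \<or> y t \<noteq> 0"
    using eventually_nonzero_of_derivative[OF dx[OF t0] _ 0(1)]
      eventually_nonzero_of_derivative[OF dy[OF t0] _ 0(2)]
    by (auto elim: eventually_mono)
  then obtain d where "d > 0"
    and nz: "\<And>t. t \<in> {0..T} \<Longrightarrow> t \<noteq> t0 \<Longrightarrow> dist t t0 < d \<Longrightarrow> x t \<noteq> 0 \<or> y t \<noteq> 0"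
    unfolding eventually_at by blast
  have w_ge: "1 / (2 * v\<^sup>2) / (t - t0)\<^sup>2 \<le> ?w t"
    if "t \<in> {0..T}" "t \<noteq> t0" "dist t t0 < d" for t
  proof -
    have pos: "(x t)\<^sup>2 + (y t)\<^sup>2 > 0"
      using nz[OF that] by (auto simp: sum_power2_gt_zero_iff)
    then have "?w t = 1 / ((x t)\<^sup>2 + (y t)\<^sup>2)"
      by (simp add: add_divide_distrib[symmetric] power2_eq_square[of "(x t)\<^sup>2 + (y t)\<^sup>2"])
    moreover have "1 / (2 * v\<^sup>2 * (t - t0)\<^sup>2) \<le> 1 / ((x t)\<^sup>2 + (y t)\<^sup>2)"
      using r_le[OF that(1)] pos by (intro divide_left_mono) (auto intro!: mult_pos_pos)
    ultimately show ?thesis by simp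
  qed
  have W_ge: "1 / (2 * v\<^sup>2) * (1 / (p - t0) - 1 / (q - t0)) \<le> W q - W p"
    if pq: "0 \<le> p" "p \<le> q" "q \<le> T" and away: "\<And>t. t \<in> {p..q} \<Longrightarrow> t \<noteq> t0 \<and> dist t t0 < d" for p q
  proof -
    have "((\<lambda>t. 1 / (2 * v\<^sup>2) / (t - t0)\<^sup>2) has_integral
        (- (1 / (2 * v\<^sup>2) / (q - t0)) - - (1 / (2 * v\<^sup>2) / (p - t0)))) {p..q}"
    proof (rule fundamental_theorem_of_calculus[OF \<open>p \<le> q\<close>])
      fix t assume "t \<in> {p..q}"
      then have "t - t0 \<noteq> 0" using away by auto
      then show "((\<lambda>t. - (1 / (2 * v\<^sup>2) / (t - t0))) has_vector_derivative 1 / (2 * v\<^sup>2) / (t - t0)\<^sup>2)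
          (at t within {p..q})"
        unfolding has_real_derivative_iff_has_vector_derivative[symmetric]
        using \<open>v > 0\<close> by (auto intro!: derivative_eq_intros simp: power2_eq_square)
    qed
    moreover have "(?w has_integral (W q - W p)) {p..q}"
      by (rule abs_continuous_on_has_integral[OF ac N dW]) (use pq in auto)
    ultimately have "- (1 / (2 * v\<^sup>2) / (q - t0)) - - (1 / (2 * v\<^sup>2) / (p - t0)) \<le> W q - W p"
      by (rule has_integral_le) (use w_ge away pq in auto)
    then show ?thesis by (simp add: right_diff_distrib)
  qed
  have "bounded (W ` {0..T})"
    by (intro compact_imp_bounded compact_continuous_image abs_continuous_on_imp_continuous_on ac
        compact_Icc)
  then obtain M where "M > 0" and M: "\<And>t. t \<in> {0..T} \<Longrightarrow> \<bar>W t\<bar> \<le> M"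
    unfolding bounded_pos by auto
  \<comment> \<open>\<open>\<sigma>\<close> selects a side of \<open>t0\<close> on which the
    interval has room: the right one unless \<open>t0 = T\<close>.\<close>
  obtain \<sigma> \<beta> where \<sigma>: "\<sigma> = 1 \<or> \<sigma> = -1" and \<beta>: "0 < \<beta>" "\<beta> < d" "t0 + \<sigma> * \<beta> \<in> {0..T}"
  proof (cases "t0 < T")
    case True
    then show thesis
      using that[of 1 "min (d / 2) (T - t0)"] \<open>d > 0\<close> t0 by auto
  next
    case False
    then show thesis
      using that[of "-1" "min (d / 2) T"] \<open>d > 0\<close> t0 \<open>T > 0\<close> by auto
  qed
  have h_bound: "1 / (2 * v\<^sup>2) * (1 / h - 1 / \<beta>) \<le> 2 * M" if "0 < h" "h \<le> \<beta>" for h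
  proof -
    have "t0 + \<sigma> * h \<in> {0..T}" using \<sigma> \<beta> that t0 by auto
    then have "\<bar>W (t0 + \<sigma> * h)\<bar> \<le> M" "\<bar>W (t0 + \<sigma> * \<beta>)\<bar> \<le> M" using M \<beta> by auto
    moreover from \<sigma> have "1 / (2 * v\<^sup>2) * (1 / h - 1 / \<beta>) \<le> \<bar>W (t0 + \<sigma> * \<beta>) - W (t0 + \<sigma> * h)\<bar>"
    proof
      assume [simp]: "\<sigma> = 1"
      show ?thesis
        using W_ge[of "t0 + h" "t0 + \<beta>"] \<beta> that t0 by (fastforce simp: dist_real_def)
    next
      assume [simp]: "\<sigma> = -1"
      show ?thesis
        using W_ge[of "t0 - \<beta>" "t0 - h"] \<beta> that t0 by (fastforce simp: dist_real_def)
    qed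
    ultimately show ?thesis by linarith
  qed
  \<comment> \<open>At \<open>h = 1 / B\<close> the bound \<open>h_bound\<close> reads
    \<open>B - 1 / \<beta> \<le> 4 * M * v\<^sup>2\<close>, which this choice violates by exactly
    1.\<close>
  define B where "B = 4 * M * v\<^sup>2 + 1 / \<beta> + 1"
  have "B > 0" "B \<ge> 1 / \<beta>" using \<open>M > 0\<close> \<beta> by (auto simp: B_def add_nonneg_pos)
  then have "1 / B \<le> \<beta>" using \<beta> by (simp add: field_simps)
  then have "1 / (2 * v\<^sup>2) * (B - 1 / \<beta>) \<le> 2 * M"
    using h_bound[of "1 / B"] \<open>B > 0\<close> by simp
  then have "B - 1 / \<beta> \<le> 4 * M * v\<^sup>2"
    using \<open>v > 0\<close> by (simp add: field_simps)
  then show False by (simp add: B_def)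
qed

section \<open>Integrals depending on a parameter\<close>

lemma continuous_on_section:
  assumes "continuous_on (U \<times> S) (\<lambda>(e, t). g e t)" "e \<in> U"
  shows "continuous_on S (g e)"
proof -
  have "continuous_on S (Pair e)"
    by (rule continuous_on_Pair[OF continuous_on_const continuous_on_id])
  then show ?thesis
    using continuous_on_compose2[OF assms(1), of S "Pair e"] assms(2) by auto
qed

text \<open>Compactness bounds the integrand, so the primitive is Lipschitz in \<open>t\<close>
  uniformly in \<open>e\<close>. Together with continuity in \<open>e\<close> for fixed
  \<open>t\<close> this gives joint continuity.\<close>

lemma primitive_jointly_continuous:
  fixes g :: "real \<Rightarrow> real \<Rightarrow> real"
  assumes cont: "continuous_on (U \<times> {0..T}) (\<lambda>(e, t). g e t)" and "compact U"
  shows "continuous_on (U \<times> {0..T}) (\<lambda>(e, t). integral {0..t} (g e))"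
proof (rule Lipschitz.continuous_on_TimesI)
  have "compact ((\<lambda>(e, t). g e t) ` (U \<times> {0..T}))"
    by (intro compact_continuous_image cont compact_Times \<open>compact U\<close> compact_Icc)
  then obtain M where "M > 0" and M: "\<And>e t. e \<in> U \<Longrightarrow> t \<in> {0..T} \<Longrightarrow> \<bar>g e t\<bar> \<le> M"
    by (auto dest!: compact_imp_bounded simp: bounded_pos)
  note cont1 = continuous_on_section[OF cont]
  have "M-lipschitz_on {0..T} (\<lambda>t. integral {0..t} (g e))" if "e \<in> U" for e
  proof (rule bounded_derivative_imp_lipschitz)
    show "((\<lambda>t. integral {0..t} (g e)) has_derivative (\<lambda>h. h *\<^sub>R g e t)) (at t within {0..T})"
      if "t \<in> {0..T}" for t
      using integral_has_vector_derivative[OF cont1[OF \<open>e \<in> U\<close>] that]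
      by (simp add: has_vector_derivative_def)
    show "onorm (\<lambda>h. h *\<^sub>R g e t) \<le> M" if "t \<in> {0..T}" for t
      using M[OF \<open>e \<in> U\<close> that]
      by (intro onorm_le) (simp add: abs_mult mult_left_mono mult.commute[of M])
  qed (use \<open>M > 0\<close> in auto)
  then show "local_lipschitz U {0..T} (\<lambda>e t. integral {0..t} (g e))"
    by (intro local_lipschitzI exI[of _ 1] exI[of _ M])
      (auto intro: lipschitz_on_subset)
  show "continuous_on U (\<lambda>e. integral {0..t} (g e))" if "t \<in> {0..T}" for t
  proof -
    have "continuous_on (U \<times> cbox 0 t) (\<lambda>(e, t). g e t)"
      by (rule continuous_on_subset[OF cont]) (use that in auto)
    then show ?thesis
      using integral_continuous_on_param[of U 0 t g] by simp
  qed
qed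

text \<open>Leibniz's rule, taken relative to \<open>U\<close> so that it covers the one-sided
  derivative at the endpoint 0 of \<open>{0..d}\<close>.\<close>

lemma primitive_parameter_derivative:
  fixes g g' :: "real \<Rightarrow> real \<Rightarrow> real"
  assumes cont: "continuous_on (U \<times> {0..T}) (\<lambda>(e, t). g e t)"
    and cont': "continuous_on (U \<times> {0..T}) (\<lambda>(e, t). g' e t)" and "convex U"
    and deriv: "\<And>e t. e \<in> U \<Longrightarrow> t \<in> {0..T} \<Longrightarrow> ((\<lambda>e. g e t) has_field_derivative g' e t) (at e within U)"
    and "e \<in> U" "t \<in> {0..T}"
  shows "((\<lambda>e. integral {0..t} (g e)) has_field_derivative integral {0..t} (g' e)) (at e within U)"
proof -
  have "continuous_on {0..t} (g e)" if "e \<in> U" for e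
    by (rule continuous_on_subset[OF continuous_on_section[OF cont that]]) (use \<open>t \<in> {0..T}\<close> in auto)
  moreover have "continuous_on (U \<times> cbox 0 t) (\<lambda>(e, t). g' e t)"
    by (rule continuous_on_subset[OF cont']) (use \<open>t \<in> {0..T}\<close> in auto)
  ultimately show ?thesis
    using leibniz_rule_field_derivative[of U 0 t g g' e] assms
    by (auto intro: integrable_continuous_interval)
qed

text \<open>Absolute continuity excludes growth across the exceptional set: every increment is the
  integral of a function bounded by \<open>L\<close>. It is what makes the heading of a feasible
  pair Lipschitz.\<close>

lemma lipschitz_on_AE_derivative:
  fixes f :: "real \<Rightarrow> 'a::euclidean_space"
  assumes ac: "abs_continuous_on {a..b} f" and N: "negligible N"
    and deriv: "\<And>t. t \<in> {a..b} - N \<Longrightarrow> (f has_vector_derivative f' t) (at t within {a..b})"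
    and bound: "\<And>t. t \<in> {a..b} - N \<Longrightarrow> norm (f' t) \<le> L" and "0 \<le> L"
  shows "L-lipschitz_on {a..b} f"
proof -
  define g where "g t = (if t \<in> N then 0 else f' t)" for t
  have *: "norm (f q - f p) \<le> L * (q - p)" if "a \<le> p" "p \<le> q" "q \<le> b" for p q
  proof -
    have "(g has_integral (f q - f p)) {p..q}"
      by (rule abs_continuous_on_has_integral[OF ac N]) (use deriv that in \<open>auto simp: g_def\<close>)
    then show ?thesis
      using has_integral_bound_real[of L "{}" g "f q - f p" p q] bound \<open>0 \<le> L\<close> that
      by (auto simp: g_def)
  qed
  show ?thesis
  proof (rule lipschitz_onI)
    fix p q assume "p \<in> {a..b}" "q \<in> {a..b}"
    then show "dist (f p) (f q) \<le> L * dist p q"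
      using *[of p q] *[of q p] by (cases "p \<le> q") (auto simp: dist_norm norm_minus_commute)
  qed fact
qed

section \<open>Lipschitz curves\<close>

text \<open>These are the \<open>W^{1,\<infinity>}\<close> functions together with a chosen
  derivative. The class contains headings with bounded control as well as all continuously
  differentiable components, is stable under pairing and linear combination, and lies inside
  \<open>W12\<close>.\<close>

definition lipschitz_curve :: "real \<Rightarrow> (real \<Rightarrow> 'a::euclidean_space) \<Rightarrow> (real \<Rightarrow> 'a) \<Rightarrow> bool" where
  "lipschitz_curve T f f' \<longleftrightarrow> (\<exists>L. L-lipschitz_on {0..T} f) \<and>
     (AE t in lebesgue_on {0..T}. (f has_vector_derivative f' t) (at t within {0..T})) \<and>
     f' \<in> borel_measurable (lebesgue_on {0..T}) \<and>
     (\<exists>B. AE t in lebesgue_on {0..T}. norm (f' t) \<le> B)"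

lemma lipschitz_curve_C1:
  fixes f :: "real \<Rightarrow> 'a::euclidean_space"
  assumes deriv: "\<And>t. t \<in> {0..T} \<Longrightarrow> (f has_vector_derivative f' t) (at t within {0..T})"
    and cont: "continuous_on {0..T} f'"
  shows "lipschitz_curve T f f'"
proof -
  have "bounded (f' ` {0..T})"
    by (intro compact_imp_bounded compact_continuous_image cont compact_Icc)
  then obtain B where "B > 0" and B: "\<And>t. t \<in> {0..T} \<Longrightarrow> norm (f' t) \<le> B"
    unfolding bounded_pos by auto
  have "B-lipschitz_on {0..T} f"
    by (rule has_vector_derivative_lipschitz[OF deriv B]) (use \<open>B > 0\<close> in auto)
  moreover have "f' \<in> borel_measurable (lebesgue_on {0..T})"
    by (intro continuous_imp_measurable_on_sets_lebesgue cont) simp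
  moreover have "AE t in lebesgue_on {0..T}. norm (f' t) \<le> B"
    by (rule AE_I2) (use B in \<open>auto simp: space_restrict_space\<close>)
  moreover have "AE t in lebesgue_on {0..T}. (f has_vector_derivative f' t) (at t within {0..T})"
    by (rule AE_I2) (use deriv in \<open>auto simp: space_restrict_space\<close>)
  ultimately show ?thesis unfolding lipschitz_curve_def by blast
qed

lemma lipschitz_curve_Pair:
  assumes f: "lipschitz_curve T f f'" and g: "lipschitz_curve T g g'"
  shows "lipschitz_curve T (\<lambda>t. (f t, g t)) (\<lambda>t. (f' t, g' t))"
proof -
  obtain L M B C where "L-lipschitz_on {0..T} f" "M-lipschitz_on {0..T} g"
    and B: "AE t in lebesgue_on {0..T}. norm (f' t) \<le> B" and C: "AE t in lebesgue_on {0..T}. norm (g' t) \<le> C"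
    using f g unfolding lipschitz_curve_def by blast
  then have "(sqrt (L\<^sup>2 + M\<^sup>2))-lipschitz_on {0..T} (\<lambda>t. (f t, g t))"
    by (intro lipschitz_on_Pair)
  moreover have "AE t in lebesgue_on {0..T}. norm (f' t, g' t) \<le> B + C"
    using B C by eventually_elim (meson add_mono norm_Pair_le order_trans)
  moreover have "AE t in lebesgue_on {0..T}.
      ((\<lambda>t. (f t, g t)) has_vector_derivative (f' t, g' t)) (at t within {0..T})"
    using f g unfolding lipschitz_curve_def
    by (auto elim!: eventually_elim2 intro: has_vector_derivative_Pair)
  moreover have "(\<lambda>t. (f' t, g' t)) \<in> borel_measurable (lebesgue_on {0..T})"
    using f g unfolding lipschitz_curve_def by (intro borel_measurable_Pair) auto
  ultimately show ?thesis unfolding lipschitz_curve_def by blast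
qed

lemma lipschitz_curve_add:
  assumes f: "lipschitz_curve T f f'" and g: "lipschitz_curve T g g'"
  shows "lipschitz_curve T (\<lambda>t. f t + c *\<^sub>R g t) (\<lambda>t. f' t + c *\<^sub>R g' t)"
proof -
  obtain L M B C where "L-lipschitz_on {0..T} f" "M-lipschitz_on {0..T} g"
    and B: "AE t in lebesgue_on {0..T}. norm (f' t) \<le> B" and C: "AE t in lebesgue_on {0..T}. norm (g' t) \<le> C"
    using f g unfolding lipschitz_curve_def by blast
  then have "(L + \<bar>c\<bar> * M)-lipschitz_on {0..T} (\<lambda>t. f t + c *\<^sub>R g t)"
    by (intro lipschitz_on_add lipschitz_on_cmult)
  moreover have "AE t in lebesgue_on {0..T}. norm (f' t + c *\<^sub>R g' t) \<le> B + \<bar>c\<bar> * C"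
    using B C
  proof eventually_elim
    case (elim t)
    have "norm (f' t + c *\<^sub>R g' t) \<le> norm (f' t) + \<bar>c\<bar> * norm (g' t)"
      by (metis norm_scaleR norm_triangle_ineq)
    also have "\<dots> \<le> B + \<bar>c\<bar> * C"
      using elim by (intro add_mono mult_left_mono) auto
    finally show ?case .
  qed
  moreover have "AE t in lebesgue_on {0..T}.
      ((\<lambda>t. f t + c *\<^sub>R g t) has_vector_derivative (f' t + c *\<^sub>R g' t)) (at t within {0..T})"
    using f g unfolding lipschitz_curve_def
    by (auto elim!: eventually_elim2 intro!: has_vector_derivative_add
        bounded_linear.has_vector_derivative[OF bounded_linear_scaleR_right])
  moreover have "(\<lambda>t. f' t + c *\<^sub>R g' t) \<in> borel_measurable (lebesgue_on {0..T})"
    using f g unfolding lipschitz_curve_def by (intro borel_measurable_add borel_measurable_scaleR) auto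
  ultimately show ?thesis unfolding lipschitz_curve_def by blast
qed

lemma lipschitz_curve_imp_abs_continuous_on:
  assumes "lipschitz_curve T f f'"
  shows "abs_continuous_on {0..T} f"
proof -
  from assms obtain L where "L-lipschitz_on {0..T} f"
    unfolding lipschitz_curve_def by (elim conjE exE)
  then show ?thesis by (rule lipschitz_imp_abs_continuous_on)
qed

lemma lipschitz_curve_imp_W12:
  assumes "lipschitz_curve T f f'"
  shows "W12 T f"
  unfolding W12_def
proof (intro conjI exI)
  show "abs_continuous_on {0..T} f"
    by (rule lipschitz_curve_imp_abs_continuous_on[OF assms])
  show "AE t in lebesgue_on {0..T}. (f has_vector_derivative f' t) (at t within {0..T})"
    and [measurable]: "f' \<in> borel_measurable (lebesgue_on {0..T})"
    using assms by (auto simp: lipschitz_curve_def)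
  obtain B where "AE t in lebesgue_on {0..T}. norm (f' t) \<le> B"
    using assms by (auto simp: lipschitz_curve_def)
  then have "AE t in lebesgue_on {0..T}. norm ((norm (f' t))\<^sup>2) \<le> B\<^sup>2"
    by eventually_elim (simp add: power_mono)
  then show "integrable (lebesgue_on {0..T}) (\<lambda>t. (norm (f' t))\<^sup>2)"
    by (intro finite_measure.integrable_const_bound finite_measure_lebesgue_on) simp_all
qed

section \<open>The information densities\<close>

text \<open>All three running terms of the dynamics, and every linear combination of them that occurs in
  the Hamiltonian, are quadratic forms divided by \<open>(x\<^sup>2 + y\<^sup>2)\<^sup>2\<close>.\<close>

definition dens :: "real \<Rightarrow> real \<Rightarrow> real \<Rightarrow> real \<Rightarrow> real \<Rightarrow> real" where
  "dens \<alpha> \<beta> \<gamma> x y = (\<alpha> * x\<^sup>2 + \<beta> * y\<^sup>2 + \<gamma> * (x * y)) / (x\<^sup>2 + y\<^sup>2)\<^sup>2"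

text \<open>The directional derivative of \<open>dens \<alpha> \<beta> \<gamma>\<close> at
  \<open>(x, y)\<close> along \<open>(\<xi>, \<zeta>)\<close>.\<close>

definition ddens :: "real \<Rightarrow> real \<Rightarrow> real \<Rightarrow> real \<Rightarrow> real \<Rightarrow> real \<Rightarrow> real \<Rightarrow> real" where
  "ddens \<alpha> \<beta> \<gamma> x y \<xi> \<zeta> =
     (2 * \<alpha> * x * \<xi> + 2 * \<beta> * y * \<zeta> + \<gamma> * (x * \<zeta> + \<xi> * y)) / (x\<^sup>2 + y\<^sup>2)\<^sup>2
     - 4 * (\<alpha> * x\<^sup>2 + \<beta> * y\<^sup>2 + \<gamma> * (x * y)) * (x * \<xi> + y * \<zeta>) / (x\<^sup>2 + y\<^sup>2) ^ 3"

lemma dens_has_field_derivative: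
  assumes "(f has_field_derivative f') (at e within U)" "(g has_field_derivative g') (at e within U)"
    and "(f e)\<^sup>2 + (g e)\<^sup>2 > 0"
  shows "((\<lambda>e. dens \<alpha> \<beta> \<gamma> (f e) (g e)) has_field_derivative ddens \<alpha> \<beta> \<gamma> (f e) (g e) f' g') (at e within U)"
proof -
  let ?r = "(f e)\<^sup>2 + (g e)\<^sup>2"
  let ?n = "\<alpha> * (f e)\<^sup>2 + \<beta> * (g e)\<^sup>2 + \<gamma> * (f e * g e)"
  let ?n' = "2 * \<alpha> * f e * f' + 2 * \<beta> * g e * g' + \<gamma> * (f e * g' + f' * g e)"
  have n: "((\<lambda>e. \<alpha> * (f e)\<^sup>2 + \<beta> * (g e)\<^sup>2 + \<gamma> * (f e * g e)) has_field_derivative ?n') (at e within U)"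
    using assms(1,2) by (auto intro!: derivative_eq_intros simp: algebra_simps)
  have r: "((\<lambda>e. ((f e)\<^sup>2 + (g e)\<^sup>2)\<^sup>2) has_field_derivative 4 * ?r * (f e * f' + g e * g')) (at e within U)"
    using assms(1,2) by (auto intro!: derivative_eq_intros simp: algebra_simps)
  have "?r \<noteq> 0" using assms(3) by linarith
  \<comment> \<open>The quotient rule produces the denominator \<open>r ^ 4\<close>; cancelling
    common powers of \<open>r\<close> gives the two fractions of \<open>ddens\<close>.\<close>
  have "(n' * r\<^sup>2 - n * (4 * r * k)) / (r\<^sup>2 * r\<^sup>2) = n' / r\<^sup>2 - 4 * n * k / r ^ 3"
    if "r \<noteq> 0" for n n' k r :: real
    using that by (simp add: field_simps power2_eq_square power3_eq_cube)
  from this[OF \<open>?r \<noteq> 0\<close>]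
  have "(?n' * ?r\<^sup>2 - ?n * (4 * ?r * (f e * f' + g e * g'))) / (?r\<^sup>2 * ?r\<^sup>2)
      = ddens \<alpha> \<beta> \<gamma> (f e) (g e) f' g'"
    unfolding ddens_def .
  then show ?thesis
    using DERIV_divide[OF n r] \<open>?r \<noteq> 0\<close> unfolding dens_def by simp
qed

lemma continuous_on_dens:
  assumes "continuous_on S f" "continuous_on S g" "\<And>s. s \<in> S \<Longrightarrow> (f s)\<^sup>2 + (g s)\<^sup>2 > 0"
  shows "continuous_on S (\<lambda>s. dens \<alpha> \<beta> \<gamma> (f s) (g s))"
proof -
  have nz: "((f s)\<^sup>2 + (g s)\<^sup>2) ^ n \<noteq> 0" if "s \<in> S" for s n
    using assms(3)[OF that] by (intro power_not_zero) linarith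
  show ?thesis
    unfolding dens_def by (intro continuous_intros assms(1,2) ballI nz)
qed

lemma continuous_on_ddens:
  assumes "continuous_on S f" "continuous_on S g" "continuous_on S h" "continuous_on S k"
    and "\<And>s. s \<in> S \<Longrightarrow> (f s)\<^sup>2 + (g s)\<^sup>2 > 0"
  shows "continuous_on S (\<lambda>s. ddens \<alpha> \<beta> \<gamma> (f s) (g s) (h s) (k s))"
proof -
  have nz: "((f s)\<^sup>2 + (g s)\<^sup>2) ^ n \<noteq> 0" if "s \<in> S" for s n
    using assms(5)[OF that] by (intro power_not_zero) linarith
  show ?thesis
    unfolding ddens_def by (intro continuous_intros assms(1-4) ballI nz)
qed

lemma dens_simps:
  "dens 1 0 0 x y = x\<^sup>2 / (x\<^sup>2 + y\<^sup>2)\<^sup>2" "dens 0 1 0 x y = y\<^sup>2 / (x\<^sup>2 + y\<^sup>2)\<^sup>2"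
  "dens 0 0 1 x y = x * y / (x\<^sup>2 + y\<^sup>2)\<^sup>2"
  by (simp_all add: dens_def)

text \<open>Splits the single density with adjoint coefficients from the Hamiltonian into the three
  densities that drive the linearised \<open>z\<close> components.\<close>

lemma ddens_linear:
  "ddens \<alpha> \<beta> \<gamma> x y \<xi> \<zeta> = \<alpha> * ddens 1 0 0 x y \<xi> \<zeta> + \<beta> * ddens 0 1 0 x y \<xi> \<zeta> + \<gamma> * ddens 0 0 1 x y \<xi> \<zeta>"
  by (simp add: ddens_def add_divide_distrib diff_divide_distrib algebra_simps)

section \<open>Feasible pairs\<close>

lemma has_vector_derivative_Pair_iff:
  "((\<lambda>t. (f t, g t)) has_vector_derivative (f', g')) (at t within S) \<longleftrightarrow>
    (f has_vector_derivative f') (at t within S) \<and> (g has_vector_derivative g') (at t within S)"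
proof
  assume *: "((\<lambda>t. (f t, g t)) has_vector_derivative (f', g')) (at t within S)"
  show "(f has_vector_derivative f') (at t within S) \<and> (g has_vector_derivative g') (at t within S)"
    using bounded_linear.has_vector_derivative[OF bounded_linear_fst *]
      bounded_linear.has_vector_derivative[OF bounded_linear_snd *] by simp
qed (auto intro: has_vector_derivative_Pair)

lemma abs_continuous_on_PairD:
  assumes "abs_continuous_on I (\<lambda>t. (f t, g t))"
  shows "abs_continuous_on I f \<and> abs_continuous_on I g"
proof (intro conjI; rule abs_continuous_on_norm_le[OF assms, of _ 1])
  show "norm (f t - f s) \<le> 1 * norm ((f t, g t) - (f s, g s))" for s t
    using norm_fst_le[of "f t - f s" "g t - g s"] by simp
  show "norm (g t - g s) \<le> 1 * norm ((f t, g t) - (f s, g s))" for s t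
    using norm_snd_le[of "g t - g s" "f t - f s"] by simp
qed

text \<open>Away from the origin the right-hand sides for \<open>x\<close>, \<open>y\<close> and the
  \<open>z\<close> components are continuous in time, so these components are continuously
  differentiable and only the heading equation is left to hold almost everywhere.\<close>

lemma feasibleI:
  assumes "T > 0" "v > 0"
    and \<theta>: "lipschitz_curve T \<theta> (\<lambda>t. u t / v)"
    and u: "AE t in lebesgue_on {0..T}. - (v * a) \<le> u t \<and> u t \<le> v * a"
    and init: "x 0 = x0" "y 0 = y0" "\<theta> 0 = \<theta>0" "z1 0 = 0" "z2 0 = 0" "z3 0 = 0"
    and dx: "\<And>t. t \<in> {0..T} \<Longrightarrow> (x has_vector_derivative v * cos (\<theta> t)) (at t within {0..T})"
    and dy: "\<And>t. t \<in> {0..T} \<Longrightarrow> (y has_vector_derivative v * sin (\<theta> t)) (at t within {0..T})"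
    and pos: "\<And>t. t \<in> {0..T} \<Longrightarrow> (x t)\<^sup>2 + (y t)\<^sup>2 > 0"
    and dz1: "\<And>t. t \<in> {0..T} \<Longrightarrow> (z1 has_vector_derivative dens 1 0 0 (x t) (y t)) (at t within {0..T})"
    and dz2: "\<And>t. t \<in> {0..T} \<Longrightarrow> (z2 has_vector_derivative dens 0 1 0 (x t) (y t)) (at t within {0..T})"
    and dz3: "\<And>t. t \<in> {0..T} \<Longrightarrow> (z3 has_vector_derivative dens 0 0 1 (x t) (y t)) (at t within {0..T})"
  shows "feasible v a T x0 y0 \<theta>0 (\<lambda>t. (x t, y t, \<theta> t, z1 t, z2 t, z3 t)) u"
proof -
  have cont: "continuous_on {0..T} x" "continuous_on {0..T} y" "continuous_on {0..T} \<theta>"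
    using continuous_on_vector_derivative[OF dx] continuous_on_vector_derivative[OF dy]
      abs_continuous_on_imp_continuous_on[OF lipschitz_curve_imp_abs_continuous_on[OF \<theta>]] by auto
  have curve: "lipschitz_curve T (\<lambda>t. (x t, y t, \<theta> t, z1 t, z2 t, z3 t))
      (\<lambda>t. (v * cos (\<theta> t), v * sin (\<theta> t), u t / v,
        dens 1 0 0 (x t) (y t), dens 0 1 0 (x t) (y t), dens 0 0 1 (x t) (y t)))"
    by (intro lipschitz_curve_Pair \<theta> lipschitz_curve_C1[OF dx] lipschitz_curve_C1[OF dy]
        lipschitz_curve_C1[OF dz1] lipschitz_curve_C1[OF dz2] lipschitz_curve_C1[OF dz3]
        continuous_on_dens cont pos continuous_intros)
  have "(\<lambda>t. u t / v) \<in> borel_measurable (lebesgue_on {0..T})"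
    using \<theta> by (simp add: lipschitz_curve_def)
  then have "(\<lambda>t. v * (u t / v)) \<in> borel_measurable (lebesgue_on {0..T})"
    by (intro borel_measurable_times borel_measurable_const)
  then have "u \<in> borel_measurable (lebesgue_on {0..T})"
    using \<open>v > 0\<close> by simp
  moreover have "AE t in lebesgue_on {0..T}. \<bar>u t\<bar> \<le> v * a"
    using u by eventually_elim auto
  ultimately have "Linfty T u" unfolding Linfty_def by blast
  moreover have "AE t in lebesgue_on {0..T}.
      ((\<lambda>t. (x t, y t, \<theta> t, z1 t, z2 t, z3 t)) has_vector_derivative
        dynamics v (x t, y t, \<theta> t, z1 t, z2 t, z3 t) (u t)) (at t within {0..T}) \<and>
      - (v * a) \<le> u t \<and> u t \<le> v * a"
    using curve u unfolding lipschitz_curve_def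
    by (auto elim!: eventually_elim2 simp: dens_simps)
  ultimately show ?thesis
    using init lipschitz_curve_imp_W12[OF curve] by (simp add: feasible_def)
qed

text \<open>The order of the arguments matters: continuity of the heading gives the equations for
  \<open>x\<close> and \<open>y\<close> at all times, these keep the curve off the origin, and only
  then are the densities continuous and the \<open>z\<close> components their primitives.\<close>

lemma feasibleD:
  assumes "T > 0" "v > 0" "a > 0"
    and feas: "feasible v a T x0 y0 \<theta>0 (\<lambda>t. (x t, y t, \<theta> t, z1 t, z2 t, z3 t)) u"
  shows "u \<in> borel_measurable (lebesgue_on {0..T})"
    and "AE t in lebesgue_on {0..T}. - (v * a) \<le> u t \<and> u t \<le> v * a"
    and "lipschitz_curve T \<theta> (\<lambda>t. u t / v)"
    and "\<theta> 0 = \<theta>0"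
    and "\<And>t. t \<in> {0..T} \<Longrightarrow> x t = x0 + integral {0..t} (\<lambda>\<tau>. v * cos (\<theta> \<tau>))"
    and "\<And>t. t \<in> {0..T} \<Longrightarrow> y t = y0 + integral {0..t} (\<lambda>\<tau>. v * sin (\<theta> \<tau>))"
    and "\<And>t. t \<in> {0..T} \<Longrightarrow> (x t)\<^sup>2 + (y t)\<^sup>2 > 0"
    and "\<And>t. t \<in> {0..T} \<Longrightarrow> z1 t = integral {0..t} (\<lambda>\<tau>. dens 1 0 0 (x \<tau>) (y \<tau>))"
    and "\<And>t. t \<in> {0..T} \<Longrightarrow> z2 t = integral {0..t} (\<lambda>\<tau>. dens 0 1 0 (x \<tau>) (y \<tau>))"
    and "\<And>t. t \<in> {0..T} \<Longrightarrow> z3 t = integral {0..t} (\<lambda>\<tau>. dens 0 0 1 (x \<tau>) (y \<tau>))"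
proof -
  let ?s = "\<lambda>t. (x t, y t, \<theta> t, z1 t, z2 t, z3 t)"
  show um: "u \<in> borel_measurable (lebesgue_on {0..T})"
    using feas by (simp add: feasible_def Linfty_def)
  have init: "x 0 = x0" "y 0 = y0" "z1 0 = 0" "z2 0 = 0" "z3 0 = 0" and \<theta>0: "\<theta> 0 = \<theta>0"
    using feas by (auto simp: feasible_def)
  show "\<theta> 0 = \<theta>0" by (rule \<theta>0)
  have ae: "AE t in lebesgue_on {0..T}.
        (?s has_vector_derivative dynamics v (?s t) (u t)) (at t within {0..T}) \<and>
        - (v * a) \<le> u t \<and> u t \<le> v * a"
    using feas by (simp add: feasible_def)
  then show "AE t in lebesgue_on {0..T}. - (v * a) \<le> u t \<and> u t \<le> v * a"
    by eventually_elim auto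
  obtain N where N: "negligible N"
    and ds: "\<And>t. t \<in> {0..T} - N \<Longrightarrow> (?s has_vector_derivative dynamics v (?s t) (u t)) (at t within {0..T})"
    and u: "\<And>t. t \<in> {0..T} - N \<Longrightarrow> - (v * a) \<le> u t \<and> u t \<le> v * a"
    using ae by (subst (asm) AE_lebesgue_on_iff_negligible) (simp, blast)
  have acs: "abs_continuous_on {0..T} ?s"
    using feas by (simp add: feasible_def W12_def)
  then have ac: "abs_continuous_on {0..T} x" "abs_continuous_on {0..T} y" "abs_continuous_on {0..T} \<theta>"
    "abs_continuous_on {0..T} z1" "abs_continuous_on {0..T} z2" "abs_continuous_on {0..T} z3"
    by (auto dest!: abs_continuous_on_PairD)
  have deriv: "(x has_vector_derivative v * cos (\<theta> t)) (at t within {0..T})"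
    "(y has_vector_derivative v * sin (\<theta> t)) (at t within {0..T})"
    "(\<theta> has_vector_derivative u t / v) (at t within {0..T})"
    "(z1 has_vector_derivative dens 1 0 0 (x t) (y t)) (at t within {0..T})"
    "(z2 has_vector_derivative dens 0 1 0 (x t) (y t)) (at t within {0..T})"
    "(z3 has_vector_derivative dens 0 0 1 (x t) (y t)) (at t within {0..T})"
    if "t \<in> {0..T} - N" for t
    using ds[OF that] by (simp_all add: has_vector_derivative_Pair_iff dens_simps)
  have bound: "norm (u t / v) \<le> a" if "t \<in> {0..T} - N" for t
    using u[OF that] \<open>v > 0\<close> by (simp add: abs_le_iff field_simps)
  have "a-lipschitz_on {0..T} \<theta>"
    by (rule lipschitz_on_AE_derivative[OF ac(3) N deriv(3) bound]) (use \<open>a > 0\<close> in auto)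
  moreover have "AE t in lebesgue_on {0..T}. (\<theta> has_vector_derivative u t / v) (at t within {0..T})"
    "AE t in lebesgue_on {0..T}. norm (u t / v) \<le> a"
    using N deriv(3) bound by (auto simp: AE_lebesgue_on_iff_negligible)
  moreover have "(\<lambda>t. u t / v) \<in> borel_measurable (lebesgue_on {0..T})"
    using um by measurable
  ultimately show "lipschitz_curve T \<theta> (\<lambda>t. u t / v)"
    unfolding lipschitz_curve_def by blast
  have c: "continuous_on {0..T} x" "continuous_on {0..T} y" "continuous_on {0..T} \<theta>"
    using ac by (auto intro: abs_continuous_on_imp_continuous_on)
  have c_cos: "continuous_on {0..T} (\<lambda>t. v * cos (\<theta> t))"
    and c_sin: "continuous_on {0..T} (\<lambda>t. v * sin (\<theta> t))"
    by (intro continuous_intros c)+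
  note dx = abs_continuous_on_continuous_derivative[OF ac(1) N deriv(1) c_cos]
    and dy = abs_continuous_on_continuous_derivative[OF ac(2) N deriv(2) c_sin]
  show "x t = x0 + integral {0..t} (\<lambda>\<tau>. v * cos (\<theta> \<tau>))" if "t \<in> {0..T}" for t
    using dx(1)[OF _ that] init by simp
  show "y t = y0 + integral {0..t} (\<lambda>\<tau>. v * sin (\<theta> \<tau>))" if "t \<in> {0..T}" for t
    using dy(1)[OF _ that] init by simp
  \<comment> \<open>The sum is the inner product of the state with a constant vector. It is the
    function \<open>W\<close> of \<open>curve_avoids_origin\<close>.\<close>
  have acW: "abs_continuous_on {0..T} (\<lambda>t. z1 t + z2 t)"
    using abs_continuous_on_inner[OF acs lipschitz_imp_abs_continuous_on[OF lipschitz_on_constant],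
        of "(0, 0, 0, 1, 1, 0)"] by simp
  have dW: "((\<lambda>t. z1 t + z2 t) has_vector_derivative
      (x t)\<^sup>2 / ((x t)\<^sup>2 + (y t)\<^sup>2)\<^sup>2 + (y t)\<^sup>2 / ((x t)\<^sup>2 + (y t)\<^sup>2)\<^sup>2) (at t within {0..T})"
    if "t \<in> {0..T} - N" for t
    using has_vector_derivative_add[OF deriv(4,5)[OF that]] by (simp add: dens_simps)
  have pos: "(x t)\<^sup>2 + (y t)\<^sup>2 > 0" if "t \<in> {0..T}" for t
    by (rule curve_avoids_origin[OF \<open>v > 0\<close> \<open>T > 0\<close> dx(2) dy(2) acW N dW that])
  then show "(x t)\<^sup>2 + (y t)\<^sup>2 > 0" if "t \<in> {0..T}" for t
    using that .
  have c_dens: "continuous_on {0..T} (\<lambda>t. dens \<alpha> \<beta> \<gamma> (x t) (y t))" for \<alpha> \<beta> \<gamma>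
    by (intro continuous_on_dens c pos)
  show "z1 t = integral {0..t} (\<lambda>\<tau>. dens 1 0 0 (x \<tau>) (y \<tau>))"
    "z2 t = integral {0..t} (\<lambda>\<tau>. dens 0 1 0 (x \<tau>) (y \<tau>))"
    "z3 t = integral {0..t} (\<lambda>\<tau>. dens 0 0 1 (x \<tau>) (y \<tau>))" if "t \<in> {0..T}" for t
    using abs_continuous_on_continuous_derivative(1)[OF ac(4) N deriv(4) c_dens that]
      abs_continuous_on_continuous_derivative(1)[OF ac(5) N deriv(5) c_dens that]
      abs_continuous_on_continuous_derivative(1)[OF ac(6) N deriv(6) c_dens that] init by simp_all
qed

section \<open>Perturbation of the heading\<close>

text \<open>The heading \<open>\<theta> + e * \<eta>\<close> determines the position
  \<open>X\<close>, \<open>Y\<close> and the accumulated densities \<open>Z\<close> by successive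
  integration. \<open>DX\<close>, \<open>DY\<close> and \<open>DZ\<close> are their derivatives in
  \<open>e\<close>, and the coefficients of \<open>Z\<close> treat the three \<open>z\<close>
  components at once.\<close>

locale heading_variation =
  fixes v T x0 y0 :: real and \<theta> \<eta> :: "real \<Rightarrow> real"
  assumes T_pos: "T > 0"
    and cont_\<theta>: "continuous_on {0..T} \<theta>" and cont_\<eta>: "continuous_on {0..T} \<eta>"
begin

definition X :: "real \<Rightarrow> real \<Rightarrow> real" where
  "X e t = x0 + integral {0..t} (\<lambda>\<tau>. v * cos (\<theta> \<tau> + e * \<eta> \<tau>))"

definition Y :: "real \<Rightarrow> real \<Rightarrow> real" where
  "Y e t = y0 + integral {0..t} (\<lambda>\<tau>. v * sin (\<theta> \<tau> + e * \<eta> \<tau>))"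

definition DX :: "real \<Rightarrow> real \<Rightarrow> real" where
  "DX e t = integral {0..t} (\<lambda>\<tau>. - (v * sin (\<theta> \<tau> + e * \<eta> \<tau>) * \<eta> \<tau>))"

definition DY :: "real \<Rightarrow> real \<Rightarrow> real" where
  "DY e t = integral {0..t} (\<lambda>\<tau>. v * cos (\<theta> \<tau> + e * \<eta> \<tau>) * \<eta> \<tau>)"

definition Z :: "real \<Rightarrow> real \<Rightarrow> real \<Rightarrow> real \<Rightarrow> real \<Rightarrow> real" where
  "Z \<alpha> \<beta> \<gamma> e t = integral {0..t} (\<lambda>\<tau>. dens \<alpha> \<beta> \<gamma> (X e \<tau>) (Y e \<tau>))"

definition DZ :: "real \<Rightarrow> real \<Rightarrow> real \<Rightarrow> real \<Rightarrow> real \<Rightarrow> real" where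
  "DZ \<alpha> \<beta> \<gamma> e t = integral {0..t} (\<lambda>\<tau>. ddens \<alpha> \<beta> \<gamma> (X e \<tau>) (Y e \<tau>) (DX e \<tau>) (DY e \<tau>))"

lemma cont_snd:
  "continuous_on (U \<times> {0..T}) (\<lambda>p. \<theta> (snd p))" "continuous_on (U \<times> {0..T}) (\<lambda>p. \<eta> (snd p))"
  by (auto intro!: continuous_on_compose2[OF cont_\<theta>] continuous_on_compose2[OF cont_\<eta>] continuous_intros)

lemma cont_integrands:
  "continuous_on (U \<times> {0..T}) (\<lambda>(e, t). v * cos (\<theta> t + e * \<eta> t))"
  "continuous_on (U \<times> {0..T}) (\<lambda>(e, t). v * sin (\<theta> t + e * \<eta> t))"
  "continuous_on (U \<times> {0..T}) (\<lambda>(e, t). - (v * sin (\<theta> t + e * \<eta> t) * \<eta> t))"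
  "continuous_on (U \<times> {0..T}) (\<lambda>(e, t). v * cos (\<theta> t + e * \<eta> t) * \<eta> t)"
  unfolding split_beta by (intro continuous_intros cont_snd)+

lemma cont_XY:
  assumes "compact U"
  shows "continuous_on (U \<times> {0..T}) (\<lambda>(e, t). X e t)" "continuous_on (U \<times> {0..T}) (\<lambda>(e, t). Y e t)"
    "continuous_on (U \<times> {0..T}) (\<lambda>(e, t). DX e t)" "continuous_on (U \<times> {0..T}) (\<lambda>(e, t). DY e t)"
  unfolding X_def Y_def DX_def DY_def split_beta
  by (intro continuous_on_add continuous_on_const
      cont_integrands[THEN primitive_jointly_continuous, OF assms, unfolded split_beta])+

lemma XY_time_derivative:
  assumes "t \<in> {0..T}"
  shows "(X e has_vector_derivative v * cos (\<theta> t + e * \<eta> t)) (at t within {0..T})"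
    "(Y e has_vector_derivative v * sin (\<theta> t + e * \<eta> t)) (at t within {0..T})"
    "(DX e has_vector_derivative - (v * sin (\<theta> t + e * \<eta> t) * \<eta> t)) (at t within {0..T})"
    "(DY e has_vector_derivative v * cos (\<theta> t + e * \<eta> t) * \<eta> t) (at t within {0..T})"
  using cont_integrands[of UNIV, THEN continuous_on_section, of e, THEN integral_has_vector_derivative, OF _ assms]
  unfolding X_def[abs_def] Y_def[abs_def] DX_def[abs_def] DY_def[abs_def]
    add.commute[of x0] add.commute[of y0] has_vector_derivative_add_const
  by simp_all

lemma XY_parameter_derivative:
  assumes "convex U" "e \<in> U" "t \<in> {0..T}"
  shows "((\<lambda>e. X e t) has_field_derivative DX e t) (at e within U)"
    "((\<lambda>e. Y e t) has_field_derivative DY e t) (at e within U)"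
proof -
  have "((\<lambda>e. integral {0..t} (\<lambda>\<tau>. v * cos (\<theta> \<tau> + e * \<eta> \<tau>))) has_field_derivative DX e t) (at e within U)"
    unfolding DX_def
    by (rule primitive_parameter_derivative[OF cont_integrands(1,3) assms(1) _ assms(2,3)])
      (auto intro!: derivative_eq_intros)
  from DERIV_add[OF DERIV_const[of x0] this]
  show "((\<lambda>e. X e t) has_field_derivative DX e t) (at e within U)"
    unfolding X_def by (simp only: add_0_left)
  have "((\<lambda>e. integral {0..t} (\<lambda>\<tau>. v * sin (\<theta> \<tau> + e * \<eta> \<tau>))) has_field_derivative DY e t) (at e within U)"
    unfolding DY_def
    by (rule primitive_parameter_derivative[OF cont_integrands(2,4) assms(1) _ assms(2,3)])
      (auto intro!: derivative_eq_intros)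
  from DERIV_add[OF DERIV_const[of y0] this]
  show "((\<lambda>e. Y e t) has_field_derivative DY e t) (at e within U)"
    unfolding Y_def by (simp only: add_0_left)
qed

text \<open>The squared distance to the origin is uniformly continuous on a compact rectangle and
  has a positive minimum \<open>m\<close> at \<open>e = 0\<close>. A change smaller than
  \<open>m\<close> cannot bring it to 0.\<close>

lemma avoids_origin_nearby:
  assumes "\<And>t. t \<in> {0..T} \<Longrightarrow> (X 0 t)\<^sup>2 + (Y 0 t)\<^sup>2 > 0"
  obtains d where "0 < d" "d \<le> 1"
    "\<And>e t. e \<in> {0..d} \<Longrightarrow> t \<in> {0..T} \<Longrightarrow> (X e t)\<^sup>2 + (Y e t)\<^sup>2 > 0"
proof -
  let ?r = "\<lambda>(e, t). (X e t)\<^sup>2 + (Y e t)\<^sup>2"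
  have r: "continuous_on ({0..1} \<times> {0..T}) ?r"
    using cont_XY(1,2)[of "{0..1}"] unfolding split_beta by (intro continuous_intros) auto
  have "continuous_on {0..T} (\<lambda>t. (X 0 t)\<^sup>2 + (Y 0 t)\<^sup>2)"
    using continuous_on_section[OF r, of 0] by simp
  then obtain s where s: "s \<in> {0..T}" "\<And>t. t \<in> {0..T} \<Longrightarrow> (X 0 s)\<^sup>2 + (Y 0 s)\<^sup>2 \<le> (X 0 t)\<^sup>2 + (Y 0 t)\<^sup>2"
    using continuous_attains_inf[of "{0..T}" "\<lambda>t. (X 0 t)\<^sup>2 + (Y 0 t)\<^sup>2"] T_pos by auto
  define m where "m = (X 0 s)\<^sup>2 + (Y 0 s)\<^sup>2"
  have "m > 0" using assms s(1) by (simp add: m_def)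
  have "uniformly_continuous_on ({0..1} \<times> {0..T}) ?r"
    by (intro compact_uniformly_continuous r compact_Times compact_Icc)
  then obtain d where "d > 0" and d: "\<And>p q. p \<in> {0..1} \<times> {0..T} \<Longrightarrow> q \<in> {0..1} \<times> {0..T} \<Longrightarrow> dist q p < d \<Longrightarrow>
      dist (?r q) (?r p) < m"
    using \<open>m > 0\<close> unfolding uniformly_continuous_on_def by blast
  show thesis
  proof (rule that[of "min 1 (d / 2)"])
    fix e t assume e: "e \<in> {0..min 1 (d / 2)}" and t: "t \<in> {0..T}"
    have "dist (?r (e, t)) (?r (0, t)) < m"
      by (rule d) (use e t \<open>d > 0\<close> in \<open>auto simp: dist_Pair_Pair\<close>)
    then show "(X e t)\<^sup>2 + (Y e t)\<^sup>2 > 0"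
      using s(2)[OF t] by (simp add: dist_real_def m_def)
  qed (use \<open>d > 0\<close> in auto)
qed

lemma Z_time_derivative:
  assumes pos: "\<And>t. t \<in> {0..T} \<Longrightarrow> (X e t)\<^sup>2 + (Y e t)\<^sup>2 > 0" and t: "t \<in> {0..T}"
  shows "(Z \<alpha> \<beta> \<gamma> e has_vector_derivative dens \<alpha> \<beta> \<gamma> (X e t) (Y e t)) (at t within {0..T})"
    and "(DZ \<alpha> \<beta> \<gamma> e has_vector_derivative ddens \<alpha> \<beta> \<gamma> (X e t) (Y e t) (DX e t) (DY e t)) (at t within {0..T})"
proof -
  have c: "continuous_on {0..T} (X e)" "continuous_on {0..T} (Y e)"
    "continuous_on {0..T} (DX e)" "continuous_on {0..T} (DY e)"
    by (rule XY_time_derivative[THEN continuous_on_vector_derivative], assumption)+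
  show "(Z \<alpha> \<beta> \<gamma> e has_vector_derivative dens \<alpha> \<beta> \<gamma> (X e t) (Y e t)) (at t within {0..T})"
    unfolding Z_def[abs_def]
    by (intro integral_has_vector_derivative continuous_on_dens c pos t)
  show "(DZ \<alpha> \<beta> \<gamma> e has_vector_derivative ddens \<alpha> \<beta> \<gamma> (X e t) (Y e t) (DX e t) (DY e t)) (at t within {0..T})"
    unfolding DZ_def[abs_def]
    by (intro integral_has_vector_derivative continuous_on_ddens c pos t)
qed

lemma Z_parameter_derivative:
  assumes U: "compact U" "convex U"
    and pos: "\<And>e t. e \<in> U \<Longrightarrow> t \<in> {0..T} \<Longrightarrow> (X e t)\<^sup>2 + (Y e t)\<^sup>2 > 0"
    and e: "e \<in> U" and t: "t \<in> {0..T}"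
  shows "((\<lambda>e. Z \<alpha> \<beta> \<gamma> e t) has_field_derivative DZ \<alpha> \<beta> \<gamma> e t) (at e within U)"
  unfolding Z_def DZ_def
proof (rule primitive_parameter_derivative[OF _ _ U(2) _ e t])
  note c = cont_XY[OF U(1), unfolded split_beta]
  show "continuous_on (U \<times> {0..T}) (\<lambda>(e, t). dens \<alpha> \<beta> \<gamma> (X e t) (Y e t))"
    unfolding split_beta by (intro continuous_on_dens c) (use pos in auto)
  show "continuous_on (U \<times> {0..T}) (\<lambda>(e, t). ddens \<alpha> \<beta> \<gamma> (X e t) (Y e t) (DX e t) (DY e t))"
    unfolding split_beta by (intro continuous_on_ddens c) (use pos in auto)
  show "((\<lambda>e. dens \<alpha> \<beta> \<gamma> (X e t) (Y e t)) has_field_derivative ddens \<alpha> \<beta> \<gamma> (X e t) (Y e t) (DX e t) (DY e t)) (at e within U)"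
    if "e \<in> U" "t \<in> {0..T}" for e t
    by (intro dens_has_field_derivative XY_parameter_derivative U pos that)
qed

text \<open>The right difference quotients of the cost at \<open>e = 0\<close> are nonnegative,
  hence so is their limit. Minimality is assumed only among curves that avoid the origin, which
  includes all small \<open>e\<close> by \<open>avoids_origin_nearby\<close>.\<close>

lemma first_variation_nonneg:
  assumes pos: "\<And>t. t \<in> {0..T} \<Longrightarrow> (X 0 t)\<^sup>2 + (Y 0 t)\<^sup>2 > 0"
    and min: "\<And>e. 0 \<le> e \<Longrightarrow> e \<le> 1 \<Longrightarrow> (\<And>t. t \<in> {0..T} \<Longrightarrow> (X e t)\<^sup>2 + (Y e t)\<^sup>2 > 0) \<Longrightarrow>
      (Z 0 0 1 0 T)\<^sup>2 - Z 1 0 0 0 T * Z 0 1 0 0 T \<le> (Z 0 0 1 e T)\<^sup>2 - Z 1 0 0 e T * Z 0 1 0 e T"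
  shows "0 \<le> 2 * Z 0 0 1 0 T * DZ 0 0 1 0 T - DZ 1 0 0 0 T * Z 0 1 0 0 T - Z 1 0 0 0 T * DZ 0 1 0 0 T"
proof -
  obtain d where d: "0 < d" "d \<le> 1"
    "\<And>e t. e \<in> {0..d} \<Longrightarrow> t \<in> {0..T} \<Longrightarrow> (X e t)\<^sup>2 + (Y e t)\<^sup>2 > 0"
    using avoids_origin_nearby pos by blast
  define J where "J e = (Z 0 0 1 e T)\<^sup>2 - Z 1 0 0 e T * Z 0 1 0 e T" for e
  have dZ: "((\<lambda>e. Z \<alpha> \<beta> \<gamma> e T) has_field_derivative DZ \<alpha> \<beta> \<gamma> 0 T) (at 0 within {0..d})" for \<alpha> \<beta> \<gamma>
    by (rule Z_parameter_derivative) (use d T_pos in auto)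
  have "(J has_field_derivative
      2 * Z 0 0 1 0 T * DZ 0 0 1 0 T - DZ 1 0 0 0 T * Z 0 1 0 0 T - Z 1 0 0 0 T * DZ 0 1 0 0 T) (at 0 within {0..d})"
    unfolding J_def[abs_def] by (auto intro!: derivative_eq_intros dZ simp: algebra_simps)
  then have lim: "((\<lambda>e. (J e - J 0) / (e - 0)) \<longlongrightarrow>
      2 * Z 0 0 1 0 T * DZ 0 0 1 0 T - DZ 1 0 0 0 T * Z 0 1 0 0 T - Z 1 0 0 0 T * DZ 0 1 0 0 T) (at 0 within {0..d})"
    by (simp add: has_field_derivative_iff)
  show ?thesis
  proof (rule tendsto_lowerbound[OF lim])
    show "\<forall>\<^sub>F e in at 0 within {0..d}. 0 \<le> (J e - J 0) / (e - 0)"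
      unfolding eventually_at_filter
      by (rule always_eventually) (use d in \<open>auto simp: J_def intro!: divide_nonneg_pos min\<close>)
    show "at 0 within {0..d} \<noteq> bot"
      using d by (simp add: trivial_limit_within)
  qed
qed

end

section \<open>The variational inequality\<close>

lemma GDERIV_directional:
  assumes "GDERIV f p :> G"
  shows "((\<lambda>r. f (p + r *\<^sub>R h)) has_field_derivative inner h G) (at 0)"
proof -
  have f: "(f has_derivative (\<lambda>h. inner h G)) (at (p + 0 *\<^sub>R h))"
    using assms by (simp add: gderiv_def)
  have "((\<lambda>r. p + r *\<^sub>R h) has_derivative (\<lambda>r. r *\<^sub>R h)) (at 0)"
    by (auto intro!: derivative_eq_intros)
  from has_derivative_compose[OF this f]
  show ?thesis by (simp add: has_field_derivative_def mult_commute_abs)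
qed

text \<open>The adjoint condition supplies the gradient only through \<open>GDERIV\<close>.
  Differentiating along the line in an arbitrary direction and comparing derivatives recovers its
  inner products.\<close>

lemma cost_gradient:
  assumes "GDERIV cost (x, y, \<theta>, z1, z2, z3) :> G"
  shows "inner (h1, h2, h3, h4, h5, h6) G = 2 * z3 * h6 - h4 * z2 - z1 * h5"
proof (rule DERIV_unique)
  show "((\<lambda>r. cost ((x, y, \<theta>, z1, z2, z3) + r *\<^sub>R (h1, h2, h3, h4, h5, h6)))
      has_field_derivative inner (h1, h2, h3, h4, h5, h6) G) (at 0)"
    by (rule GDERIV_directional[OF assms])
  show "((\<lambda>r. cost ((x, y, \<theta>, z1, z2, z3) + r *\<^sub>R (h1, h2, h3, h4, h5, h6)))
      has_field_derivative 2 * z3 * h6 - h4 * z2 - z1 * h5) (at 0)"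
    by (auto intro!: derivative_eq_intros)
qed

lemma hamiltonian_gradient:
  assumes "GDERIV (\<lambda>\<sigma>. hamiltonian v \<sigma> u (lx, ly, l\<theta>, lz1, lz2, lz3)) (x, y, \<theta>, z1, z2, z3) :> G"
    and pos: "x\<^sup>2 + y\<^sup>2 > 0"
  shows "inner (h1, h2, h3, h4, h5, h6) G =
    - (lx * (v * sin \<theta> * h3)) + ly * (v * cos \<theta> * h3) + ddens lz1 lz2 lz3 x y h1 h2"
proof (rule DERIV_unique)
  let ?H = "\<lambda>r. hamiltonian v ((x, y, \<theta>, z1, z2, z3) + r *\<^sub>R (h1, h2, h3, h4, h5, h6)) u (lx, ly, l\<theta>, lz1, lz2, lz3)"
  show "(?H has_field_derivative inner (h1, h2, h3, h4, h5, h6) G) (at 0)"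
    by (rule GDERIV_directional[OF assms(1)])
  \<comment> \<open>The three fractions merge into one \<open>dens\<close> whose coefficients are
    the adjoint components, so a single application of its chain rule suffices.\<close>
  have H: "?H = (\<lambda>r. lx * v * cos (\<theta> + r * h3) + ly * v * sin (\<theta> + r * h3) + l\<theta> * (u / v)
      + dens lz1 lz2 lz3 (x + r * h1) (y + r * h2))"
    by (auto simp: dens_def add_divide_distrib)
  have "((\<lambda>r. dens lz1 lz2 lz3 (x + r * h1) (y + r * h2)) has_field_derivative
      ddens lz1 lz2 lz3 (x + 0 * h1) (y + 0 * h2) h1 h2) (at 0)"
    by (rule dens_has_field_derivative) (use pos in \<open>auto intro!: derivative_eq_intros\<close>)
  then show "(?H has_field_derivative
      - (lx * (v * sin \<theta> * h3)) + ly * (v * cos \<theta> * h3) + ddens lz1 lz2 lz3 x y h1 h2) (at 0)"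
    unfolding H by (auto intro!: derivative_eq_intros simp: algebra_simps)
qed

text \<open>The derivative of the pairing \<open>\<langle>\<delta>s, \<lambda>\<rangle>\<close> of the linearised trajectory with the adjoint
  variable is \<open>\<lambda>\<^sub>\<theta> (w - u) / v\<close>, and the end value of the pairing is the derivative of the cost along the
  convex perturbation \<open>(1 - e) u + e w\<close>.\<close>

lemma variational_inequality:
  fixes v a tf x0 y0 \<theta>0 :: real
    and x y \<theta> z1 z2 z3 u :: "real \<Rightarrow> real"
    and lx ly l\<theta> lz1 lz2 lz3 :: "real \<Rightarrow> real"
  assumes "v > 0" and "a > 0" and "tf > 0"
    and opt: "optimal v a tf x0 y0 \<theta>0 (\<lambda>t. (x t, y t, \<theta> t, z1 t, z2 t, z3 t)) u"
    and adj: "adjoint_of v tf (\<lambda>t. (x t, y t, \<theta> t, z1 t, z2 t, z3 t)) u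
           (\<lambda>t. (lx t, ly t, l\<theta> t, lz1 t, lz2 t, lz3 t))"
    and cont_w: "continuous_on {0..tf} w" and w: "\<And>t. t \<in> {0..tf} \<Longrightarrow> \<bar>w t\<bar> \<le> v * a"
  shows "\<exists>D\<ge>0. ((\<lambda>t. l\<theta> t * (w t / v - u t / v)) has_integral D) {0..tf}"
proof -
  have feas: "feasible v a tf x0 y0 \<theta>0 (\<lambda>t. (x t, y t, \<theta> t, z1 t, z2 t, z3 t)) u"
    and opt': "\<And>s' u'. feasible v a tf x0 y0 \<theta>0 s' u' \<Longrightarrow> cost (x tf, y tf, \<theta> tf, z1 tf, z2 tf, z3 tf) \<le> cost (s' tf)"
    using opt by (auto simp: optimal_def)
  note fD = feasibleD[OF \<open>tf > 0\<close> \<open>v > 0\<close> \<open>a > 0\<close> feas]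
  \<comment> \<open>\<open>\<eta>\<close> is the heading steered by \<open>w\<close> from the same
    initial value minus the given heading. Hence \<open>\<theta> + e * \<eta>\<close> is the heading
    belonging to \<open>(1 - e) * u + e * w\<close>.\<close>
  define \<eta> where "\<eta> t = (integral {0..t} (\<lambda>\<tau>. w \<tau> / v) + \<theta>0) + (-1) *\<^sub>R \<theta> t" for t
  have cont_wv: "continuous_on {0..tf} (\<lambda>t. w t / v)"
    using cont_w \<open>v > 0\<close> by (intro continuous_intros) auto
  have "lipschitz_curve tf (\<lambda>t. integral {0..t} (\<lambda>\<tau>. w \<tau> / v) + \<theta>0) (\<lambda>t. w t / v)"
    by (rule lipschitz_curve_C1[OF _ cont_wv], subst has_vector_derivative_add_const)
      (rule integral_has_vector_derivative[OF cont_wv])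
  from lipschitz_curve_add[OF this fD(3), of "-1"]
  have curve_\<eta>: "lipschitz_curve tf \<eta> (\<lambda>t. w t / v - u t / v)"
    unfolding \<eta>_def[abs_def] by simp
  have \<eta>0: "\<eta> 0 = 0" by (simp add: \<eta>_def fD(4))
  have cont_\<theta>: "continuous_on {0..tf} \<theta>" and cont_\<eta>: "continuous_on {0..tf} \<eta>"
    using fD(3) curve_\<eta> by (auto intro: abs_continuous_on_imp_continuous_on lipschitz_curve_imp_abs_continuous_on)
  interpret V: heading_variation v tf x0 y0 \<theta> \<eta>
    by unfold_locales (use \<open>tf > 0\<close> cont_\<theta> cont_\<eta> in auto)
  have X0: "V.X 0 t = x t" and Y0: "V.Y 0 t = y t" if "t \<in> {0..tf}" for t
    using fD(5,6)[OF that] by (simp_all add: V.X_def V.Y_def)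
  have Z0: "V.Z 1 0 0 0 tf = z1 tf" "V.Z 0 1 0 0 tf = z2 tf" "V.Z 0 0 1 0 tf = z3 tf"
    unfolding V.Z_def using fD(8-10)[of tf] \<open>tf > 0\<close> X0 Y0 by (auto intro!: integral_cong)
  have pos0: "(V.X 0 t)\<^sup>2 + (V.Y 0 t)\<^sup>2 > 0" if "t \<in> {0..tf}" for t
    using fD(7)[OF that] X0[OF that] Y0[OF that] by simp
  have feas_e: "feasible v a tf x0 y0 \<theta>0
      (\<lambda>t. (V.X e t, V.Y e t, \<theta> t + e * \<eta> t, V.Z 1 0 0 e t, V.Z 0 1 0 e t, V.Z 0 0 1 e t))
      (\<lambda>t. (1 - e) * u t + e * w t)"
    if "0 \<le> e" "e \<le> 1" and pos: "\<And>t. t \<in> {0..tf} \<Longrightarrow> (V.X e t)\<^sup>2 + (V.Y e t)\<^sup>2 > 0" for e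
  proof (rule feasibleI[OF \<open>tf > 0\<close> \<open>v > 0\<close>])
    have "(\<lambda>t. u t / v + e *\<^sub>R (w t / v - u t / v)) = (\<lambda>t. ((1 - e) * u t + e * w t) / v)"
      using \<open>v > 0\<close> by (auto simp: field_simps)
    then show "lipschitz_curve tf (\<lambda>t. \<theta> t + e * \<eta> t) (\<lambda>t. ((1 - e) * u t + e * w t) / v)"
      using lipschitz_curve_add[OF fD(3) curve_\<eta>, of e] by simp
    have "AE t in lebesgue_on {0..tf}. t \<in> {0..tf}"
      by (rule AE_I2) (simp add: space_restrict_space)
    with fD(2) show "AE t in lebesgue_on {0..tf}. - (v * a) \<le> (1 - e) * u t + e * w t \<and> (1 - e) * u t + e * w t \<le> v * a"
    proof eventually_elim
      case (elim t)
      then have b: "u t \<le> v * a" "- (v * a) \<le> u t" "w t \<le> v * a" "- (v * a) \<le> w t"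
        using w[of t] by (auto simp: abs_le_iff)
      have "0 \<le> 1 - e" using that(2) by simp
      note b(1,2)[THEN mult_left_mono, OF this] b(3,4)[THEN mult_left_mono, OF that(1)]
      then show ?case by (simp add: algebra_simps)
    qed
    show "V.X e 0 = x0" "V.Y e 0 = y0" "V.Z 1 0 0 e 0 = 0" "V.Z 0 1 0 e 0 = 0" "V.Z 0 0 1 e 0 = 0"
      by (simp_all add: V.X_def V.Y_def V.Z_def)
    show "\<theta> 0 + e * \<eta> 0 = \<theta>0" by (simp add: \<eta>0 fD(4))
  qed (use V.XY_time_derivative V.Z_time_derivative pos in auto)
  \<comment> \<open>The one-sided derivative of the terminal cost at \<open>e = 0\<close> along the
    perturbation.\<close>
  define D where "D = 2 * z3 tf * V.DZ 0 0 1 0 tf - V.DZ 1 0 0 0 tf * z2 tf - z1 tf * V.DZ 0 1 0 0 tf"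
  have "D \<ge> 0"
    unfolding D_def Z0[symmetric]
  proof (rule V.first_variation_nonneg[OF pos0])
    fix e assume e: "0 \<le> e" "e \<le> (1::real)" "\<And>t. t \<in> {0..tf} \<Longrightarrow> 0 < (V.X e t)\<^sup>2 + (V.Y e t)\<^sup>2"
    show "(V.Z 0 0 1 0 tf)\<^sup>2 - V.Z 1 0 0 0 tf * V.Z 0 1 0 0 tf
        \<le> (V.Z 0 0 1 e tf)\<^sup>2 - V.Z 1 0 0 e tf * V.Z 0 1 0 e tf"
      using opt'[OF feas_e[OF e]] by (simp add: Z0)
  qed
  let ?l = "\<lambda>t. (lx t, ly t, l\<theta> t, lz1 t, lz2 t, lz3 t)"
  let ?ds = "\<lambda>t. (V.DX 0 t, V.DY 0 t, \<eta> t, V.DZ 1 0 0 0 t, V.DZ 0 1 0 0 t, V.DZ 0 0 1 0 t)"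
  let ?ds' = "\<lambda>t. (- (v * sin (\<theta> t) * \<eta> t), v * cos (\<theta> t) * \<eta> t, w t / v - u t / v,
      ddens 1 0 0 (x t) (y t) (V.DX 0 t) (V.DY 0 t), ddens 0 1 0 (x t) (y t) (V.DX 0 t) (V.DY 0 t),
      ddens 0 0 1 (x t) (y t) (V.DX 0 t) (V.DY 0 t))"
  have dX: "(V.DX 0 has_vector_derivative - (v * sin (\<theta> t) * \<eta> t)) (at t within {0..tf})"
    and dY: "(V.DY 0 has_vector_derivative v * cos (\<theta> t) * \<eta> t) (at t within {0..tf})"
    if "t \<in> {0..tf}" for t
    using V.XY_time_derivative(3,4)[OF that, of 0] by simp_all
  have dZ: "(V.DZ \<alpha> \<beta> \<gamma> 0 has_vector_derivative ddens \<alpha> \<beta> \<gamma> (x t) (y t) (V.DX 0 t) (V.DY 0 t)) (at t within {0..tf})"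
    if "t \<in> {0..tf}" for t \<alpha> \<beta> \<gamma>
    using V.Z_time_derivative(2)[OF pos0 that] by (simp add: X0[OF that] Y0[OF that])
  have "continuous_on {0..tf} x" "continuous_on {0..tf} y"
    using continuous_on_eq[OF continuous_on_vector_derivative[OF V.XY_time_derivative(1)[of _ 0]]]
      continuous_on_eq[OF continuous_on_vector_derivative[OF V.XY_time_derivative(2)[of _ 0]]] X0 Y0
    by blast+
  note c = this continuous_on_vector_derivative[OF dX] continuous_on_vector_derivative[OF dY]
  have curve: "lipschitz_curve tf ?ds ?ds'"
    by (intro lipschitz_curve_Pair curve_\<eta> lipschitz_curve_C1[OF dX] lipschitz_curve_C1[OF dY]
        lipschitz_curve_C1[OF dZ] continuous_on_ddens c fD(7) continuous_intros cont_\<theta> cont_\<eta>)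
  have ac: "abs_continuous_on {0..tf} (\<lambda>t. inner (?ds t) (?l t))"
    using adj by (intro abs_continuous_on_inner lipschitz_curve_imp_abs_continuous_on[OF curve])
      (simp add: adjoint_of_def)
  have "AE t in lebesgue_on {0..tf}. t \<in> {0..tf}"
    by (rule AE_I2) (simp add: space_restrict_space)
  moreover have "AE t in lebesgue_on {0..tf}. (?ds has_vector_derivative ?ds' t) (at t within {0..tf})"
    using curve by (simp only: lipschitz_curve_def)
  moreover have "AE t in lebesgue_on {0..tf}.
      \<exists>G. GDERIV (\<lambda>\<sigma>. hamiltonian v \<sigma> (u t) (?l t)) (x t, y t, \<theta> t, z1 t, z2 t, z3 t) :> G \<and>
            (?l has_vector_derivative - G) (at t within {0..tf})"
    using adj by (simp only: adjoint_of_def)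
  ultimately have "AE t in lebesgue_on {0..tf}.
      ((\<lambda>t. inner (?ds t) (?l t)) has_vector_derivative l\<theta> t * (w t / v - u t / v)) (at t within {0..tf})"
  proof eventually_elim
    case (elim t)
    then obtain G where G: "GDERIV (\<lambda>\<sigma>. hamiltonian v \<sigma> (u t) (?l t)) (x t, y t, \<theta> t, z1 t, z2 t, z3 t) :> G"
      and dl: "(?l has_vector_derivative - G) (at t within {0..tf})" by blast
    have "((\<lambda>t. inner (?ds t) (?l t)) has_vector_derivative inner (?ds t) (- G) + inner (?ds' t) (?l t)) (at t within {0..tf})"
      by (rule bounded_bilinear.has_vector_derivative[OF bounded_bilinear_inner elim(2) dl])
    \<comment> \<open>The adjoint equation is the negative transpose of the linearised dynamics, so
      all state terms cancel and only the forcing by the control difference survives.\<close>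
    moreover have "inner (?ds t) (- G) + inner (?ds' t) (?l t) = l\<theta> t * (w t / v - u t / v)"
      using hamiltonian_gradient[OF G fD(7)[OF elim(1)], of "V.DX 0 t" "V.DY 0 t" "\<eta> t" "V.DZ 1 0 0 0 t" "V.DZ 0 1 0 0 t" "V.DZ 0 0 1 0 t"]
      by (simp add: ddens_linear[of "lz1 t"] algebra_simps)
    ultimately show ?case by (simp only:)
  qed
  then obtain N where "negligible N" and N: "\<And>t. t \<in> {0..tf} - N \<Longrightarrow>
      ((\<lambda>t. inner (?ds t) (?l t)) has_vector_derivative l\<theta> t * (w t / v - u t / v)) (at t within {0..tf})"
    by (subst (asm) AE_lebesgue_on_iff_negligible) (simp, blast)
  have "((\<lambda>t. l\<theta> t * (w t / v - u t / v)) has_integral (inner (?ds tf) (?l tf) - inner (?ds 0) (?l 0))) {0..tf}"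
    using \<open>tf > 0\<close> by (intro fundamental_theorem_of_calculus_abs_continuous[OF _ ac \<open>negligible N\<close> N]) auto
  \<comment> \<open>The terminal condition makes the adjoint at \<open>tf\<close> the gradient of
    the cost. At time 0 the pairing vanishes because all perturbed trajectories share the initial
    state.\<close>
  moreover have "inner (?ds tf) (?l tf) = D"
    using adj unfolding adjoint_of_def D_def by (intro cost_gradient) blast
  moreover have "inner (?ds 0) (?l 0) = 0"
    by (simp add: V.DX_def V.DY_def V.DZ_def \<eta>0)
  ultimately show ?thesis using \<open>D \<ge> 0\<close> by auto
qed

section \<open>Deduction of the switching law from the variational inequality\<close>

theorem proposition1:
  fixes v a tf x0 y0 \<theta>0 :: real
    and x y \<theta> z1 z2 z3 u :: "real \<Rightarrow> real"
    and lx ly l\<theta> lz1 lz2 lz3 :: "real \<Rightarrow> real"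
  assumes "v > 0" and "a > 0" and "tf > 0"
    and "optimal v a tf x0 y0 \<theta>0 (\<lambda>t. (x t, y t, \<theta> t, z1 t, z2 t, z3 t)) u"
    and "adjoint_of v tf (\<lambda>t. (x t, y t, \<theta> t, z1 t, z2 t, z3 t)) u
           (\<lambda>t. (lx t, ly t, l\<theta> t, lz1 t, lz2 t, lz3 t))"
  shows "AE t in lebesgue_on {0..tf}.
           (l\<theta> t < 0 \<longrightarrow> u t = v * a) \<and>
           (l\<theta> t > 0 \<longrightarrow> u t = - (v * a)) \<and>
           (l\<theta> t = 0 \<longrightarrow> \<bar>u t\<bar> \<le> v * a)"
proof -
  have feas: "feasible v a tf x0 y0 \<theta>0 (\<lambda>t. (x t, y t, \<theta> t, z1 t, z2 t, z3 t)) u"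
    using assms(4) by (simp add: optimal_def)
  note um = feasibleD(1)[OF \<open>tf > 0\<close> \<open>v > 0\<close> \<open>a > 0\<close> feas]
    and u_bound = feasibleD(2)[OF \<open>tf > 0\<close> \<open>v > 0\<close> \<open>a > 0\<close> feas]
  have "v * a > 0" using assms by simp
  have "abs_continuous_on {0..tf} l\<theta>"
    using assms(5) unfolding adjoint_of_def by (auto dest!: abs_continuous_on_PairD)
  then have cont_l: "continuous_on {0..tf} l\<theta>" by (rule abs_continuous_on_imp_continuous_on)
  then have lm: "l\<theta> \<in> borel_measurable (lebesgue_on {0..tf})"
    by (intro continuous_imp_measurable_on_sets_lebesgue) auto
  have "bounded (l\<theta> ` {0..tf})"
    by (intro compact_imp_bounded compact_continuous_image cont_l compact_Icc)
  then obtain M where "M > 0" and M: "\<And>t. t \<in> {0..tf} \<Longrightarrow> \<bar>l\<theta> t\<bar> \<le> M"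
    unfolding bounded_pos by auto
  \<comment> \<open>\<open>K\<close> measures how far \<open>u\<close> is from minimising
    \<open>l\<theta> t * u t\<close> over the admissible values: the least value is
    \<open>- (v * a * \<bar>l\<theta> t\<bar>)\<close>.\<close>
  define K where "K t = v * a * \<bar>l\<theta> t\<bar> + l\<theta> t * u t" for t
  have lu: "\<bar>l\<theta> t * u t\<bar> \<le> v * a * \<bar>l\<theta> t\<bar>" if "- (v * a) \<le> u t \<and> u t \<le> v * a" for t
    unfolding abs_mult using that by (subst mult.commute) (intro mult_right_mono, auto simp: abs_le_iff)
  have K_nonneg: "AE t in lebesgue_on {0..tf}. 0 \<le> K t"
    using u_bound
  proof eventually_elim
    case (elim t)
    from lu[OF elim] show ?case unfolding K_def by linarith
  qed
  have "AE t in lebesgue_on {0..tf}. t \<in> {0..tf}"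
    by (rule AE_I2) (simp add: space_restrict_space)
  with u_bound have "AE t in lebesgue_on {0..tf}. norm (K t) \<le> 2 * (v * a * M)"
  proof eventually_elim
    case (elim t)
    have "v * a * \<bar>l\<theta> t\<bar> \<le> v * a * M"
      using M[OF elim(2)] \<open>v * a > 0\<close> by (intro mult_left_mono) auto
    then show ?case using lu[OF elim(1)] \<open>v * a > 0\<close> unfolding K_def real_norm_def by linarith
  qed
  moreover have "K \<in> borel_measurable (lebesgue_on {0..tf})"
    unfolding K_def[abs_def] using um lm by measurable
  ultimately have K_int: "integrable (lebesgue_on {0..tf}) K"
    by (intro finite_measure.integrable_const_bound finite_measure_lebesgue_on) simp_all
  define I where "I = integral\<^sup>L (lebesgue_on {0..tf}) K"
  have K_hk: "(K has_integral I) {0..tf}"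
    unfolding I_def using K_int by (intro has_integral_integral_lebesgue_on) auto
  have I_le: "I \<le> v * a * e * tf" if "e > 0" for e
  proof -
    \<comment> \<open>A regularised version of \<open>- v * a\<close> times the sign of
      \<open>l\<theta>\<close>: the positive \<open>e\<close> keeps the denominator away from 0, so
      \<open>w\<close> is continuous and admissible.\<close>
    define w where "w t = - (v * a * l\<theta> t / (\<bar>l\<theta> t\<bar> + e))" for t
    have den: "\<bar>l\<theta> t\<bar> + e > 0" for t using that by simp
    have "continuous_on {0..tf} w"
      unfolding w_def using den by (intro continuous_intros cont_l) (metis less_irrefl)
    moreover have "\<bar>w t\<bar> \<le> v * a" for t
    proof -
      have "v * a * \<bar>l\<theta> t\<bar> \<le> v * a * (\<bar>l\<theta> t\<bar> + e)"
        using \<open>v * a > 0\<close> that by (intro mult_left_mono) auto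
      then show ?thesis
        using den[of t] \<open>v > 0\<close> \<open>a > 0\<close> by (simp add: w_def abs_mult pos_divide_le_eq)
    qed
    ultimately obtain D where "D \<ge> 0"
      and D: "((\<lambda>t. l\<theta> t * (w t / v - u t / v)) has_integral D) {0..tf}"
      using variational_inequality[OF assms] by blast
    have "((\<lambda>t. v * a * e - v * (l\<theta> t * (w t / v - u t / v))) has_integral
        (v * a * e * tf - v * D)) {0..tf}"
      using \<open>tf > 0\<close> has_integral_const_real[of "v * a * e" 0 tf]
      by (intro has_integral_diff has_integral_mult_right D) (simp add: mult.commute)
    \<comment> \<open>The regularisation loses at most \<open>v * a * e\<close> pointwise, because
      \<open>\<bar>l\<theta> t\<bar> - l\<theta> t * l\<theta> t / (\<bar>l\<theta> t\<bar> +
      e)\<close> equals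
      \<open>e * \<bar>l\<theta> t\<bar> / (\<bar>l\<theta> t\<bar> + e)\<close>.\<close>
    moreover have "K t \<le> v * a * e - v * (l\<theta> t * (w t / v - u t / v))" for t
    proof -
      have "\<bar>l\<theta> t\<bar> * (\<bar>l\<theta> t\<bar> + e) - l\<theta> t * l\<theta> t \<le> e * (\<bar>l\<theta> t\<bar> + e)"
        using that by (simp add: algebra_simps)
      then have "\<bar>l\<theta> t\<bar> - l\<theta> t * l\<theta> t / (\<bar>l\<theta> t\<bar> + e) \<le> e"
        using den[of t] by (simp add: field_simps)
      then have "v * a * (\<bar>l\<theta> t\<bar> - l\<theta> t * l\<theta> t / (\<bar>l\<theta> t\<bar> + e)) \<le> v * a * e"
        using \<open>v * a > 0\<close> by (intro mult_left_mono) auto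
      moreover have "v * (l\<theta> t * (w t / v - u t / v)) = l\<theta> t * w t - l\<theta> t * u t"
        using \<open>v > 0\<close> by (simp add: field_simps)
      ultimately show ?thesis
        by (simp add: K_def w_def right_diff_distrib algebra_simps)
    qed
    ultimately have "I \<le> v * a * e * tf - v * D"
      by (intro has_integral_le[OF K_hk]) auto
    moreover have "v * D \<ge> 0" using \<open>v > 0\<close> \<open>D \<ge> 0\<close> by simp
    ultimately show ?thesis by linarith
  qed
  have "I \<le> 0"
  proof (rule field_le_epsilon)
    fix e :: real assume "e > 0"
    then show "I \<le> 0 + e"
      using I_le[of "e / (v * a * tf)"] \<open>v > 0\<close> \<open>a > 0\<close> \<open>tf > 0\<close> by simp
  qed
  moreover have "I \<ge> 0"
    unfolding I_def by (rule integral_nonneg_AE[OF K_nonneg])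
  ultimately have "AE t in lebesgue_on {0..tf}. K t = 0"
    using integral_nonneg_eq_0_iff_AE[OF K_int K_nonneg] by (simp add: I_def)
  with u_bound show ?thesis
  proof eventually_elim
    case (elim t)
    \<comment> \<open>Once the sign of \<open>l\<theta> t\<close> resolves the absolute value,
      \<open>K t\<close> is the product on the left-hand side, and its first factor is
      nonzero.\<close>
    have "l\<theta> t * (u t - v * a) = 0" if "l\<theta> t < 0"
      using elim(2) that by (simp add: K_def algebra_simps)
    moreover have "l\<theta> t * (u t + v * a) = 0" if "l\<theta> t > 0"
      using elim(2) that by (simp add: K_def algebra_simps)
    ultimately show ?case using elim(1) by (auto simp: abs_le_iff)
  qed
qed

end
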